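(* Let $T$ be an infinite locally finite rooted tree, with infinitely many branching vertices, and let $\ell$ be a length function on $T$. Assume that $(T,\ell)$ is weakly complete. Then the following two statements are equivalent: (1) the random walk $RW(T,\ell)$ is transient; (2) the limit $H(T,\ell)=\lim_{n\to\infty}\frac1n\,n!_{(T,\ell)}\in(0,\infty]$ is finite. Equivalently, $RW(T,\ell)$ is recurrent if and only if $H(T,\ell)=\infty$.
   Context: $T$ has root $\mathfrak r$ and edges oriented away from the root. A length function is $\ell:E(T)\to\mathbb R_{+}$ with (strictly) positive values. A vertex is branching if it has at least two children. A leaf is a vertex $v\neq\mathfrak r$ of valence one. Factorials: $\widetilde\partial T$ is the set of all infinite oriented paths from $\mathfrak r$ together with all oriented paths from $\mathfrak r$ to a leaf. For distinct $\rho,\tau\in\widetilde\partial T$, $\langle\rho,\tau\rangle$ is the sum of $\ell(e)$ over common edges $e$. Choose $\rho_0\in\widetilde\partial T$ arbitrarily; given $\rho_0,\dots,\rho_{n-1}$ choose $\rho_n\in\widetilde\partial T\setminus\{\rho_0,\dots,\rho_{n-1}\}$ minimizing $\sum_{j<n}\langle\rho,\rho_j\rangle$; set $n!_{(T,\ell)}:=\sum_{j<n}\langle\rho_n,\rho_j\rangle$. These numbers are independent of the choices; the sequence is infinite when $T$ has infinitely many branching vertices, and then $\frac1n n!_{(T,\ell)}$ converges in $(0,\infty]$ to a limit denoted $H(T,\ell)$. Random walk: for an edge $uv$ put $c(u,v)=c(v,u)=1/\ell(uv)$. $RW(T,\ell)$ is the nearest-neighbour random walk on the vertices of $T$ started at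 $\mathfrak r$ with transition probabilities $p_{uv}=c(u,v)/\sum_{w\sim u}c(u,w)$. It is transient if almost surely it returns to the root only finitely many times; otherwise it is recurrent. Weakly complete: for every vertex $v$, every infinite oriented path starting at $v$ none of whose vertices other than $v$ is branching has infinite total $\ell$-length. *)

theory Defs
  imports "HOL-Probability.Probability" "Graph_Theory.Graph_Theory"
begin

section \<open>Rooted trees with edge lengths\<close>

text \<open>
  A rooted tree is given together with the orientation of its edges away from the root: it is a
  digraph in which every vertex is the end of exactly one directed walk from the root. Arcs are
  pairs (parent, child), so \<open>out_arcs T v\<close> corresponds to the children of \<open>v\<close>. The notion
  \<open>tree\<close> of the graph library excludes directed cycles only, hence it is not used here.
\<close>

locale rooted_tree = pair_wf_digraph T for T :: "'a pair_pre_digraph" +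
  fixes r :: 'a
  assumes root_in_verts: "r \<in> pverts T"
    and unique_awalk: "v \<in> pverts T \<Longrightarrow> \<exists>!p. awalk r p v"

definition locally_finite :: "'a pair_pre_digraph \<Rightarrow> bool" where
  "locally_finite T \<longleftrightarrow> (\<forall>v\<in>pverts T. finite (in_arcs T v) \<and> finite (out_arcs T v))"

text \<open>
  The degrees of the graph library are cardinalities, with value \<open>0\<close> on infinite sets; the next two
  notions have their intended meaning in locally finite trees.
\<close>

definition branching :: "'a pair_pre_digraph \<Rightarrow> 'a \<Rightarrow> bool" where
  "branching T v \<longleftrightarrow> v \<in> pverts T \<and> 2 \<le> out_degree T v"

definition leaf :: "'a pair_pre_digraph \<Rightarrow> 'a \<Rightarrow> 'a \<Rightarrow> bool" where
  "leaf T r v \<longleftrightarrow> v \<in> pverts T \<and> v \<noteq> r \<and> in_degree T v + out_degree T v = 1"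

definition length_function :: "'a pair_pre_digraph \<Rightarrow> ('a \<times> 'a \<Rightarrow> real) \<Rightarrow> bool" where
  "length_function T l \<longleftrightarrow> (\<forall>e\<in>parcs T. 0 < l e)"

text \<open>Infinite oriented paths are represented by their sequences of arcs.\<close>

definition infinite_walk :: "'a pair_pre_digraph \<Rightarrow> 'a \<Rightarrow> (nat \<Rightarrow> 'a \<times> 'a) \<Rightarrow> bool" where
  "infinite_walk T v p \<longleftrightarrow>
     fst (p 0) = v \<and> (\<forall>i. p i \<in> parcs T \<and> snd (p i) = fst (p (Suc i)))"

text \<open>The vertices of the path \<open>p\<close> after its initial vertex \<open>v\<close> are the heads \<open>snd (p i)\<close>.\<close>

definition weakly_complete :: "'a pair_pre_digraph \<Rightarrow> ('a \<times> 'a \<Rightarrow> real) \<Rightarrow> bool" where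
  "weakly_complete T l \<longleftrightarrow>
     (\<forall>v\<in>pverts T. \<forall>p. infinite_walk T v p \<and> (\<forall>i. \<not> branching T (snd (p i))) \<longrightarrow>
        (\<Sum>i. ennreal (l (p i))) = \<infinity>)"


section \<open>Factorials\<close>

datatype 'a root_path = Infinite_path "nat \<Rightarrow> 'a \<times> 'a" | Finite_path "('a \<times> 'a) list"

fun path_arcs :: "'a root_path \<Rightarrow> ('a \<times> 'a) set" where
  "path_arcs (Infinite_path p) = range p"
| "path_arcs (Finite_path p) = set p"

definition boundary :: "'a pair_pre_digraph \<Rightarrow> 'a \<Rightarrow> 'a root_path set" where
  "boundary T r =
     {Infinite_path p | p. infinite_walk T r p} \<union>
     {Finite_path p | p v. leaf T r v \<and> pre_digraph.awalk T r p v}"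

text \<open>Only used for distinct paths, which have finitely many common arcs.\<close>

definition pairing :: "('a \<times> 'a \<Rightarrow> real) \<Rightarrow> 'a root_path \<Rightarrow> 'a root_path \<Rightarrow> real" where
  "pairing l \<rho> \<tau> = (\<Sum>e\<in>path_arcs \<rho> \<inter> path_arcs \<tau>. l e)"

text \<open>
  The sequences of choices in the definition of the factorials. For \<open>n = 0\<close> the minimized sum is
  empty, so that \<open>\<rho> 0\<close> is an arbitrary element of the boundary.
\<close>

definition minimizing_sequence ::
  "'a pair_pre_digraph \<Rightarrow> 'a \<Rightarrow> ('a \<times> 'a \<Rightarrow> real) \<Rightarrow> (nat \<Rightarrow> 'a root_path) \<Rightarrow> bool" where
  "minimizing_sequence T r l \<rho> \<longleftrightarrow>
     (\<forall>n. is_arg_min (\<lambda>\<sigma>. \<Sum>j<n. pairing l \<sigma> (\<rho> j)) (\<lambda>\<sigma>. \<sigma> \<in> boundary T r - \<rho> ` {..<n}) (\<rho> n))"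

text \<open>
  The factorials of \<open>(T, l)\<close> and the limit of their quotients by \<open>n\<close>, as computed from a minimizing
  sequence \<open>\<rho>\<close>. The values do not depend on \<open>\<rho>\<close>; statements about them are made for every \<open>\<rho>\<close>.
\<close>

definition tree_factorial :: "('a \<times> 'a \<Rightarrow> real) \<Rightarrow> (nat \<Rightarrow> 'a root_path) \<Rightarrow> nat \<Rightarrow> real" where
  "tree_factorial l \<rho> n = (\<Sum>j<n. pairing l (\<rho> n) (\<rho> j))"

definition factorial_limit :: "('a \<times> 'a \<Rightarrow> real) \<Rightarrow> (nat \<Rightarrow> 'a root_path) \<Rightarrow> ereal" where
  "factorial_limit l \<rho> = lim (\<lambda>n. ereal (tree_factorial l \<rho> n / real n))"


section \<open>The random walk\<close>

definition neighbours :: "'a pair_pre_digraph \<Rightarrow> 'a \<Rightarrow> 'a set" where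
  "neighbours T u = {w. (u, w) \<in> parcs T \<or> (w, u) \<in> parcs T}"

definition conductance :: "'a pair_pre_digraph \<Rightarrow> ('a \<times> 'a \<Rightarrow> real) \<Rightarrow> 'a \<Rightarrow> 'a \<Rightarrow> real" where
  "conductance T l u v =
     (if (u, v) \<in> parcs T then 1 / l (u, v)
      else if (v, u) \<in> parcs T then 1 / l (v, u)
      else 0)"

definition transition_prob :: "'a pair_pre_digraph \<Rightarrow> ('a \<times> 'a \<Rightarrow> real) \<Rightarrow> 'a \<Rightarrow> 'a \<Rightarrow> real" where
  "transition_prob T l u v = conductance T l u v / (\<Sum>w\<in>neighbours T u. conductance T l u w)"

text \<open>
  The process \<open>X\<close> on the probability space \<open>M\<close> is a Markov chain on the vertices, started at \<open>r\<close>,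
  with the above transition probabilities.
\<close>

definition random_walk ::
  "'a pair_pre_digraph \<Rightarrow> 'a \<Rightarrow> ('a \<times> 'a \<Rightarrow> real) \<Rightarrow> 'b measure \<Rightarrow> (nat \<Rightarrow> 'b \<Rightarrow> 'a) \<Rightarrow> bool" where
  "random_walk T r l M X \<longleftrightarrow>
     prob_space M \<and>
     (\<forall>n. X n \<in> measurable M (count_space (pverts T))) \<and>
     (AE \<omega> in M. X 0 \<omega> = r) \<and>
     (\<forall>n x. \<P>(\<omega> in M. \<forall>i\<le>n. X i \<omega> = x i) \<noteq> 0 \<longrightarrow>
        (\<forall>v\<in>pverts T.
           \<P>(\<omega> in M. X (Suc n) \<omega> = v \<bar> \<forall>i\<le>n. X i \<omega> = x i) = transition_prob T l (x n) v))"

definition transient :: "'a \<Rightarrow> 'b measure \<Rightarrow> (nat \<Rightarrow> 'b \<Rightarrow> 'a) \<Rightarrow> bool" where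
  "transient r M X \<longleftrightarrow> (AE \<omega> in M. finite {n. 0 < n \<and> X n \<omega> = r})"

definition recurrent :: "'a \<Rightarrow> 'b measure \<Rightarrow> (nat \<Rightarrow> 'b \<Rightarrow> 'a) \<Rightarrow> bool" where
  "recurrent r M X \<longleftrightarrow> \<not> transient r M X"

end

theory Submission
  imports Defs
begin

text \<open>
  Let \<open>h v\<close> be the probability that the walk started at \<open>v\<close> never hits the root (and \<open>h r = 0\<close>). It
  is harmonic off the root and increases along edges, so its gradient is a flow from the root, of
  strength \<open>s\<close> say, and the walk is transient iff \<open>s > 0\<close>: the events "the last visit to the root
  happens at time \<open>n\<close>" are disjoint and have probability proportional to \<open>s\<close> times the probability of
  being at the root at time \<open>n\<close>. In fact \<open>n!/n\<close> converges to \<open>1/s\<close>.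

  Upper bound: for a path drawn at random from the normalised flow, the expected pairing with any
  fixed path is at most \<open>1/s\<close>, as the gradient of \<open>h\<close> telescopes along that path. Hence some path has
  total pairing at most \<open>n/s\<close> with the first \<open>n\<close> chosen ones; weak completeness yields a competitor
  if that path has already been chosen.

  Lower bound: the first \<open>n\<close> paths form a flow of strength about \<open>n\<close> whose energy is essentially
  twice the sum of the first \<open>n\<close> factorials. By Cauchy-Schwarz against the potential of the walk
  stopped after \<open>m\<close> steps, whose energy is at most its outflow at the root, this sum is at least
  \<open>n\<^sup>2/(2 s) - o(n\<^sup>2)\<close>. Monotonicity of the factorials turns the bound on averages into convergence.
\<close>

section \<open>Rooted trees and boundary paths\<close>

locale weighted_tree = rooted_tree T r for T :: "'a pair_pre_digraph" and r :: 'a +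
  fixes l :: "'a \<times> 'a \<Rightarrow> real"
  assumes locally_finite: "locally_finite T"
    and infinite_verts: "infinite (pverts T)"
    and length_function: "length_function T l"
begin

section \<open>Walks from the root, depth, children and parents\<close>

definition walk_to :: "'a \<Rightarrow> ('a \<times> 'a) list" where
  "walk_to v = (THE p. awalk r p v)"

definition depth :: "'a \<Rightarrow> nat" where
  "depth v = length (walk_to v)"

definition children :: "'a \<Rightarrow> 'a set" where
  "children u = {v. (u, v) \<in> parcs T}"

definition parent :: "'a \<Rightarrow> 'a" where
  "parent v = (THE u. (u, v) \<in> parcs T)"

lemma awalk_walk_to: "v \<in> pverts T \<Longrightarrow> awalk r (walk_to v) v"
  unfolding walk_to_def by (rule theI') (rule unique_awalk)

lemma walk_to_eqI:
  assumes "awalk r p v"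
  shows "walk_to v = p"
proof -
  have "v \<in> pverts T" using assms by (rule awalk_last_in_verts)
  then show ?thesis using unique_awalk[of v] assms awalk_walk_to by blast
qed

lemma walk_to_inj:
  assumes "u \<in> pverts T" "v \<in> pverts T" "walk_to u = walk_to v"
  shows "u = v"
proof -
  have "awlast r (walk_to u) = u" "awlast r (walk_to v) = v"
    using assms(1,2)[THEN awalk_walk_to] by simp_all
  then show ?thesis using assms(3) by simp
qed

lemma arc_in_verts:
  assumes "(u, v) \<in> parcs T"
  shows "u \<in> pverts T" "v \<in> pverts T"
  using assms by (auto dest: in_arcsD1 in_arcsD2)

lemma walk_to_arc:
  assumes "(u, v) \<in> parcs T"
  shows "walk_to v = walk_to u @ [(u, v)]"
proof (rule walk_to_eqI)
  have "awalk u [(u, v)] v"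
    using assms arc_in_verts[OF assms] by (simp add: awalk_simps)
  then show "awalk r (walk_to u @ [(u, v)]) v"
    using awalk_walk_to[of u] arc_in_verts[OF assms] by (auto intro: awalk_appendI)
qed

lemma walk_to_root [simp]: "walk_to r = []"
  by (rule walk_to_eqI) (simp add: awalk_simps root_in_verts)

lemma depth_root [simp]: "depth r = 0"
  by (simp add: depth_def)

lemma depth_arc: "(u, v) \<in> parcs T \<Longrightarrow> depth v = Suc (depth u)"
  by (simp add: depth_def walk_to_arc)

lemma arc_parent_unique: "(u, v) \<in> parcs T \<Longrightarrow> (u', v) \<in> parcs T \<Longrightarrow> u = u'"
  using walk_to_arc[of u v] walk_to_arc[of u' v] by simp

lemma no_arc_to_root: "(u, r) \<notin> parcs T"
  using depth_arc[of u r] by auto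

lemma no_reverse_arc: "(u, v) \<in> parcs T \<Longrightarrow> (v, u) \<notin> parcs T"
  using depth_arc[of u v] depth_arc[of v u] by auto

lemma parent_eq: "(u, v) \<in> parcs T \<Longrightarrow> parent v = u"
  unfolding parent_def using arc_parent_unique by blast

lemma parent_arc:
  assumes "v \<in> pverts T" "v \<noteq> r"
  shows "(parent v, v) \<in> parcs T"
proof -
  have w: "awalk r (walk_to v) v" using awalk_walk_to assms by blast
  then have ne: "walk_to v \<noteq> []" using assms by (auto simp: awalk_simps)
  obtain p e where pe: "walk_to v = p @ [e]" using ne by (metis rev_exhaust)
  have "awalk (fst e) [e] v"
    using w unfolding pe by (auto simp: awalk_simps)
  then have "(fst e, v) \<in> parcs T" by (auto simp: awalk_simps)
  then show ?thesis using parent_eq by metis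
qed

lemma in_childrenD:
  assumes "c \<in> children v"
  shows "(v, c) \<in> parcs T" "v \<in> pverts T" "c \<in> pverts T" "c \<noteq> r" "parent c = v"
    "depth c = Suc (depth v)"
  using assms arc_in_verts[of v c] no_arc_to_root[of v] parent_eq[of v c] depth_arc[of v c]
  by (auto simp: children_def)

lemma depth_eq_0_iff: "v \<in> pverts T \<Longrightarrow> depth v = 0 \<longleftrightarrow> v = r"
  using parent_arc[of v] depth_arc[of "parent v" v] by fastforce

lemma finite_children [simp, intro]: "finite (children v)"
proof (cases "v \<in> pverts T")
  case True
  have "children v = snd ` out_arcs T v" by (force simp: children_def out_arcs_def)
  then show ?thesis using True locally_finite by (simp add: locally_finite_def)
next
  case False
  then have "children v = {}" by (auto simp: children_def dest: arc_in_verts)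
  then show ?thesis by simp
qed

lemma out_degree_eq: "out_degree T v = card (children v)"
proof -
  have "out_arcs T v = Pair v ` children v" by (force simp: children_def out_arcs_def)
  then show ?thesis unfolding out_degree_def by (simp add: card_image inj_on_def)
qed

lemma in_degree_eq_1: "v \<in> pverts T \<Longrightarrow> v \<noteq> r \<Longrightarrow> in_degree T v = 1"
proof -
  assume v: "v \<in> pverts T" "v \<noteq> r"
  have "in_arcs T v = {(parent v, v)}"
    using parent_arc[OF v] by (auto simp: in_arcs_def dest: parent_eq)
  then show ?thesis by (simp add: in_degree_def)
qed

lemma leaf_iff: "leaf T r v \<longleftrightarrow> v \<in> pverts T \<and> v \<noteq> r \<and> children v = {}"
  using in_degree_eq_1[of v] by (auto simp: leaf_def out_degree_eq)

section \<open>Levels and edge lengths\<close>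

definition level :: "nat \<Rightarrow> 'a set" where
  "level k = {v \<in> pverts T. depth v = k}"

lemma level_0: "level 0 = {r}"
  using depth_eq_0_iff root_in_verts by (auto simp: level_def)

lemma level_Suc: "level (Suc k) = (\<Union>v\<in>level k. children v)"
proof
  show "level (Suc k) \<subseteq> (\<Union>v\<in>level k. children v)"
  proof
    fix v assume v: "v \<in> level (Suc k)"
    then have "v \<noteq> r" "v \<in> pverts T" by (auto simp: level_def)
    from parent_arc[OF this(2,1)] v show "v \<in> (\<Union>v\<in>level k. children v)"
      using depth_arc arc_in_verts by (fastforce simp: level_def children_def)
  qed
qed (auto simp: level_def dest: in_childrenD)

lemma finite_level [simp]: "finite (level k)"
  by (induction k) (auto simp: level_0 level_Suc)

lemma verts_eq_levels: "pverts T = (\<Union>k. level k)"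
  by (auto simp: level_def)

lemma finite_depth_le: "finite {v \<in> pverts T. depth v \<le> k}"
proof -
  have "{v \<in> pverts T. depth v \<le> k} = (\<Union>i\<in>{..k}. level i)" by (auto simp: level_def)
  then show ?thesis by simp
qed

lemma children_disjoint: "u \<noteq> v \<Longrightarrow> children u \<inter> children v = {}"
  by (auto simp: children_def dest: arc_parent_unique)

lemma sum_level_Suc:
  fixes f :: "'a \<Rightarrow> 'c::comm_monoid_add"
  shows "sum f (level (Suc k)) = (\<Sum>v\<in>level k. sum f (children v))"
  unfolding level_Suc by (rule sum.UNION_disjoint) (auto dest: children_disjoint)

text \<open>Otherwise all levels beyond the first would be empty and the tree would be
  finite.\<close>

lemma children_root_nonempty: "children r \<noteq> {}"
proof
  assume "children r = {}"
  then have "level (Suc k) = {}" for k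
    by (induction k) (auto simp: level_Suc level_0)
  then have "level k \<subseteq> {r}" for k by (cases k) (auto simp: level_0)
  then have "pverts T \<subseteq> {r}" using verts_eq_levels by auto
  then show False using infinite_verts finite_subset by blast
qed

definition len :: "'a \<Rightarrow> real" where
  "len v = l (parent v, v)"

lemma len_pos: "v \<in> pverts T \<Longrightarrow> v \<noteq> r \<Longrightarrow> 0 < len v"
  using parent_arc length_function by (auto simp: len_def length_function_def)

lemma len_child: "c \<in> children v \<Longrightarrow> len c = l (v, c)"
  by (simp add: len_def in_childrenD)

lemma len_child_pos: "c \<in> children v \<Longrightarrow> 0 < len c"
  using len_pos in_childrenD by metis

section \<open>Arcs and vertices of boundary paths\<close>

definition path_verts :: "'a root_path \<Rightarrow> 'a set" where
  "path_verts \<sigma> = insert r (snd ` path_arcs \<sigma>)"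

lemma walk_to_infinite_walk:
  assumes "infinite_walk T r p"
  shows "walk_to (snd (p i)) = map p [0..<Suc i]"
proof -
  have arc: "(fst (p i), snd (p i)) \<in> parcs T" for i
    using assms unfolding infinite_walk_def prod.collapse by blast
  have start: "fst (p 0) = r" and link: "fst (p (Suc i)) = snd (p i)" for i
    using assms by (simp_all add: infinite_walk_def)
  show ?thesis
  proof (induction i)
    case 0
    show ?case using walk_to_arc[OF arc[of 0]] start by (simp add: prod_eq_iff)
  next
    case (Suc i)
    have "map p [0..<Suc (Suc i)] = map p [0..<Suc i] @ [p (Suc i)]" by simp
    then show ?case using walk_to_arc[OF arc[of "Suc i"]] Suc link[of i] by (simp del: upt_Suc) (simp add: prod_eq_iff)
  qed
qed

text \<open>A common form for finite and infinite paths: the arcs are enumerated along an initial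
  segment of the natural numbers, and the uniqueness of walks identifies each piece of the path with
  a \<open>walk_to\<close>.\<close>

lemma boundary_enum:
  assumes "\<sigma> \<in> boundary T r"
  obtains p I where "path_arcs \<sigma> = p ` I" "I = UNIV \<or> (\<exists>k. I = {..<k})"
    "\<And>i. i \<in> I \<Longrightarrow> p i \<in> parcs T"
    "\<And>i. i \<in> I \<Longrightarrow> walk_to (snd (p i)) = map p [0..<Suc i]"
proof -
  consider p where "\<sigma> = Infinite_path p" "infinite_walk T r p"
    | p v where "\<sigma> = Finite_path p" "awalk r p v"
    using assms by (auto simp: boundary_def)
  then show ?thesis
  proof cases
    case 1
    then have p: "p i \<in> parcs T" "snd (p i) = fst (p (Suc i))" "fst (p 0) = r" for i
      by (auto simp: infinite_walk_def)
    have w: "walk_to (snd (p i)) = map p [0..<Suc i]" for i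
      using 1 walk_to_infinite_walk by blast
    show ?thesis by (rule that[of p UNIV]) (use 1 p w in auto)
  next
    case 2
    have w: "walk_to (snd (p ! i)) = take (Suc i) p" if "i < length p" for i
    proof (rule walk_to_eqI)
      have "p = take i p @ p ! i # drop (Suc i) p" using that by (rule id_take_nth_drop)
      with 2 have "awalk r (take i p @ p ! i # drop (Suc i) p) v" by simp
      then have "awalk r (take i p @ [p ! i]) (snd (p ! i))"
        by (auto simp: awalk_simps)
      then show "awalk r (take (Suc i) p) (snd (p ! i))"
        using that by (simp add: take_Suc_conv_app_nth)
    qed
    have "take (Suc i) p = map ((!) p) [0..<Suc i]" if "i < length p" for i
      using that by (intro nth_equalityI) (simp_all del: upt_Suc)
    moreover have "p ! i \<in> parcs T" if "i < length p" for i
      using 2(2) that by (auto simp: awalk_def)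
    moreover have "set p = (!) p ` {..<length p}" by (auto simp: set_conv_nth)
    ultimately show ?thesis by (intro that[of "(!) p" "{..<length p}"]) (use 2 w in auto)
  qed
qed

lemma path_arcs_subset: "\<sigma> \<in> boundary T r \<Longrightarrow> path_arcs \<sigma> \<subseteq> parcs T"
  by (erule boundary_enum) auto

lemma path_verts_in_verts: "\<sigma> \<in> boundary T r \<Longrightarrow> path_verts \<sigma> \<subseteq> pverts T"
  using path_arcs_subset arc_in_verts root_in_verts by (fastforce simp: path_verts_def)

lemma root_in_path_verts [simp]: "r \<in> path_verts \<sigma>"
  by (simp add: path_verts_def)

lemma head_in_path_verts_iff:
  assumes "\<sigma> \<in> boundary T r" "(u, v) \<in> parcs T"
  shows "v \<in> path_verts \<sigma> \<longleftrightarrow> (u, v) \<in> path_arcs \<sigma>"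
proof
  assume "v \<in> path_verts \<sigma>"
  moreover have "v \<noteq> r" using assms no_arc_to_root by auto
  ultimately obtain u' where "(u', v) \<in> path_arcs \<sigma>" by (auto simp: path_verts_def)
  moreover from this have "(u', v) \<in> parcs T" using path_arcs_subset[OF assms(1)] by auto
  ultimately show "(u, v) \<in> path_arcs \<sigma>" using arc_parent_unique assms by blast
qed (force simp: path_verts_def)

text \<open>A vertex determines every path through it up to its own depth. Hence two paths that
  share a vertex agree above it.\<close>

lemma walk_to_arcs:
  assumes "\<sigma> \<in> boundary T r" "v \<in> path_verts \<sigma>"
  shows "set (walk_to v) = {e \<in> path_arcs \<sigma>. depth (snd e) \<le> depth v}"
proof -
  obtain p I where p: "path_arcs \<sigma> = p ` I" "I = UNIV \<or> (\<exists>k. I = {..<k})"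
    "\<And>i. i \<in> I \<Longrightarrow> p i \<in> parcs T"
    "\<And>i. i \<in> I \<Longrightarrow> walk_to (snd (p i)) = map p [0..<Suc i]"
    using boundary_enum[OF assms(1)] by metis
  have d: "depth (snd (p i)) = Suc i" if "i \<in> I" for i
    using p(4)[OF that] by (simp add: depth_def del: upt_Suc)
  show ?thesis
  proof (cases "v = r")
    case True
    then have "walk_to v = []" "depth v = 0" by simp_all
    moreover have "0 < depth (snd e)" if "e \<in> path_arcs \<sigma>" for e
      using that d unfolding p(1) by fastforce
    ultimately show ?thesis by auto
  next
    case False
    then obtain i where i: "i \<in> I" "v = snd (p i)" using assms(2) p(1) by (auto simp: path_verts_def)
    have I: "j \<in> I" if "j \<le> i" for j using p(2) that i by auto
    have "set (walk_to v) = p ` {..i}" unfolding i(2) p(4)[OF i(1)]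
      by (simp add: atLeast0LessThan lessThan_Suc_atMost del: upt_Suc)
    also have "\<dots> = {e \<in> p ` I. depth (snd e) \<le> Suc i}"
    proof (intro equalityI subsetI)
      fix e assume "e \<in> p ` {..i}"
      then obtain j where "j \<le> i" "e = p j" by blast
      then show "e \<in> {e \<in> p ` I. depth (snd e) \<le> Suc i}" using I[of j] d[of j] by simp
    next
      fix e assume "e \<in> {e \<in> p ` I. depth (snd e) \<le> Suc i}"
      then obtain j where "j \<in> I" "e = p j" "depth (snd e) \<le> Suc i" by blast
      then show "e \<in> p ` {..i}" using d[of j] by simp
    qed
    finally show ?thesis using p(1) d[OF i(1)] i(2) by simp
  qed
qed

lemma walk_to_verts:
  assumes "\<sigma> \<in> boundary T r" "v \<in> path_verts \<sigma>"
  shows "insert r (snd ` set (walk_to v)) = {u \<in> path_verts \<sigma>. depth u \<le> depth v}"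
  using walk_to_arcs[OF assms] by (auto simp: path_verts_def)

lemma path_arcs_inj_depth:
  assumes "\<sigma> \<in> boundary T r" "e \<in> path_arcs \<sigma>" "e' \<in> path_arcs \<sigma>"
    "depth (snd e) = depth (snd e')"
  shows "e = e'"
proof -
  obtain p I where p: "path_arcs \<sigma> = p ` I" "I = UNIV \<or> (\<exists>k. I = {..<k})"
    "\<And>i. i \<in> I \<Longrightarrow> walk_to (snd (p i)) = map p [0..<Suc i]"
    using boundary_enum[OF assms(1)] by metis
  have d: "depth (snd (p i)) = Suc i" if "i \<in> I" for i
    using p(3)[OF that] by (simp add: depth_def del: upt_Suc)
  then show ?thesis using assms(2-) p(1) by auto
qed

lemma path_verts_inj_depth:
  assumes "\<sigma> \<in> boundary T r" "u \<in> path_verts \<sigma>" "v \<in> path_verts \<sigma>" "depth u = depth v"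
  shows "u = v"
proof -
  have uv: "u \<in> pverts T" "v \<in> pverts T" using path_verts_in_verts[OF assms(1)] assms by auto
  show ?thesis
  proof (cases "u = r \<or> v = r")
    case True
    then show ?thesis using uv depth_eq_0_iff assms(4) by metis
  next
    case False
    then show ?thesis using assms path_arcs_inj_depth[OF assms(1)] by (auto simp: path_verts_def)
  qed
qed

lemma parent_in_path_verts:
  assumes "\<sigma> \<in> boundary T r" "v \<in> path_verts \<sigma>" "(u, v) \<in> parcs T"
  shows "u \<in> path_verts \<sigma>"
proof (cases "u = r")
  case False
  then have "(parent u, u) \<in> parcs T" using parent_arc arc_in_verts[OF assms(3)] by auto
  then have "u \<in> insert r (snd ` set (walk_to v))"
    using walk_to_arc[OF assms(3)] walk_to_arc[of "parent u" u] by auto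
  then show ?thesis using walk_to_verts[OF assms(1,2)] by auto
qed auto

text \<open>An infinite path meets every level, so a path that misses level \<open>k\<close> is
  finite and determined by its end vertex, for which local finiteness leaves finitely many
  candidates.\<close>

lemma finite_boundary_shallow:
  "finite {\<sigma> \<in> boundary T r. path_verts \<sigma> \<inter> level k = {}}"
proof (rule finite_subset)
  show "{\<sigma> \<in> boundary T r. path_verts \<sigma> \<inter> level k = {}}
    \<subseteq> Finite_path ` walk_to ` {v \<in> pverts T. depth v \<le> k}"
  proof safe
    fix \<sigma> assume s: "\<sigma> \<in> boundary T r" "path_verts \<sigma> \<inter> level k = {}"
    then obtain m where k: "k = Suc m" by (cases k) (auto simp: level_0)
    have inP: "path_verts \<sigma> \<subseteq> pverts T" by (rule path_verts_in_verts[OF s(1)])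
    obtain p I where p: "path_arcs \<sigma> = p ` I" "I = UNIV \<or> (\<exists>k. I = {..<k})"
      "\<And>i. i \<in> I \<Longrightarrow> walk_to (snd (p i)) = map p [0..<Suc i]"
      using boundary_enum[OF s(1)] by metis
    have "m \<notin> I"
    proof
      assume m: "m \<in> I"
      then have "snd (p m) \<in> path_verts \<sigma>" using p(1) by (auto simp: path_verts_def)
      moreover have "depth (snd (p m)) = k"
        using p(3)[OF m] k by (simp add: depth_def del: upt_Suc)
      ultimately show False using s(2) inP by (auto simp: level_def)
    qed
    have dle: "depth u \<le> k" if "u \<in> path_verts \<sigma>" for u
      using that p(1) unfolding path_verts_def
    proof (elim insertE, simp)
      assume "u \<in> snd ` path_arcs \<sigma>"
      then obtain i where i: "i \<in> I" "u = snd (p i)" using p(1) by auto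
      with \<open>m \<notin> I\<close> p(2) have "i < m" by (cases "m \<le> i") (auto simp: not_le)
      then show "depth u \<le> k" using i(2) p(3)[OF i(1)] k by (simp add: depth_def del: upt_Suc)
    qed
    from s(1) consider q where "\<sigma> = Infinite_path q" "infinite_walk T r q"
      | q v where "\<sigma> = Finite_path q" "awalk r q v"
      by (auto simp: boundary_def)
    then show "\<sigma> \<in> Finite_path ` walk_to ` {v \<in> pverts T. depth v \<le> k}"
    proof cases
      case 1
      then have "depth (snd (q k)) = Suc k"
        using walk_to_infinite_walk[of q k] by (simp add: depth_def del: upt_Suc)
      moreover have "snd (q k) \<in> path_verts \<sigma>" using 1 by (auto simp: path_verts_def)
      ultimately show ?thesis using dle[of "snd (q k)"] by simp
    next
      case 2
      then have q: "walk_to v = q" "v \<in> pverts T" using walk_to_eqI awalk_last_in_verts by auto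
      have "v \<in> path_verts \<sigma>"
      proof (cases q rule: rev_cases)
        case Nil
        then have "v = r" using 2 by (auto simp: awalk_simps)
        then show ?thesis by simp
      next
        case (snoc q' e)
        then have "snd e = v" using 2 by (auto simp: awalk_simps)
        then show ?thesis using 2 snoc by (auto simp: path_verts_def)
      qed
      then show ?thesis using q 2 dle by auto
    qed
  qed
  show "finite (Finite_path ` walk_to ` {v \<in> pverts T. depth v \<le> k})"
    using finite_depth_le by blast
qed

text \<open>A finite path has bounded depth. Two infinite paths that differ at position
  \<open>i\<close> share no arc from that position on, since the walk to the head of a common arc
  fixes all earlier arcs.\<close>

lemma common_arcs_bounded:
  assumes "\<sigma> \<in> boundary T r" "\<tau> \<in> boundary T r" "\<sigma> \<noteq> \<tau>"
  shows "\<exists>K. \<forall>e \<in> path_arcs \<sigma> \<inter> path_arcs \<tau>. depth (snd e) \<le> K"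
proof -
  have fin: "\<exists>K. \<forall>e \<in> path_arcs \<pi>. depth (snd e) \<le> K" if "\<pi> = Finite_path p" for \<pi> p
    using that by (intro exI[of _ "Max ((depth \<circ> snd) ` set p)"]) auto
  show ?thesis
  proof (cases \<sigma>)
    case (Finite_path p)
    then show ?thesis using fin by (metis IntE)
  next
    case p: (Infinite_path p)
    show ?thesis
    proof (cases \<tau>)
      case (Finite_path q)
      then show ?thesis using fin by (metis IntE)
    next
      case q: (Infinite_path q)
      have w: "walk_to (snd (f i)) = map f [0..<Suc i]" if "Infinite_path f \<in> boundary T r" for f i
        using that by (intro walk_to_infinite_walk) (auto simp: boundary_def)
      obtain i where i: "p i \<noteq> q i" using assms p q by auto
      show ?thesis
      proof (intro exI[of _ i] ballI)
        fix e assume "e \<in> path_arcs \<sigma> \<inter> path_arcs \<tau>"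
        then have "e \<in> range p" "e \<in> range q" using p q by simp_all
        then obtain j k where jk: "e = p j" "e = q k" by blast
        have eq: "map p [0..<Suc j] = map q [0..<Suc k]"
          using w[of p j] w[of q k] assms p q jk by metis
        then have "j = k" by (metis length_map length_upt minus_nat.diff_0 nat.inject)
        have "\<not> i \<le> j"
        proof
          assume "i \<le> j"
          then have "p i = map p [0..<Suc j] ! i" "q i = map q [0..<Suc k] ! i"
            using \<open>j = k\<close> by (simp_all del: upt_Suc)
          with eq i show False by simp
        qed
        then show "depth (snd e) \<le> i" using w[of p j] assms p jk by (simp add: depth_def del: upt_Suc)
      qed
    qed
  qed
qed

lemma finite_common_arcs:
  assumes "\<sigma> \<in> boundary T r" "\<tau> \<in> boundary T r" "\<sigma> \<noteq> \<tau>"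
  shows "finite (path_arcs \<sigma> \<inter> path_arcs \<tau>)"
proof -
  obtain K where K: "\<And>e. e \<in> path_arcs \<sigma> \<inter> path_arcs \<tau> \<Longrightarrow> depth (snd e) \<le> K"
    using common_arcs_bounded[OF assms] by blast
  have "inj_on (depth \<circ> snd) (path_arcs \<sigma> \<inter> path_arcs \<tau>)"
    using path_arcs_inj_depth[OF assms(1)] by (auto simp: inj_on_def)
  moreover have "(depth \<circ> snd) ` (path_arcs \<sigma> \<inter> path_arcs \<tau>) \<subseteq> {..K}" using K by auto
  ultimately show ?thesis using finite_subset finite_imageD by blast
qed

lemma infinite_path_in_boundary:
  assumes "x 0 = r" "\<And>i. x (Suc i) \<in> children (x i)"
  shows "Infinite_path (\<lambda>i. (x i, x (Suc i))) \<in> boundary T r"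
  using assms by (auto simp: boundary_def infinite_walk_def children_def)

lemma finite_path_in_boundary:
  assumes "leaf T r v" "awalk r p v"
  shows "Finite_path p \<in> boundary T r"
  using assms by (auto simp: boundary_def)

text \<open>Descend from the root, staying on the walk to \<open>v\<close> as long as possible and
  choosing children arbitrarily afterwards. The descent goes on forever or stops at a leaf.\<close>

lemma boundary_through:
  assumes "v \<in> pverts T"
  obtains \<sigma> where "\<sigma> \<in> boundary T r" "v \<in> path_verts \<sigma>"
proof -
  \<comment> \<open>Ancestry is expressed by prefixes: \<open>pref c\<close> holds for the vertices
    on the walk to \<open>v\<close>.\<close>
  define pref where "pref c \<longleftrightarrow> (\<exists>t. walk_to c @ t = walk_to v)" for c
  define f where "f u = (if \<exists>c\<in>children u. pref c then SOME c. c \<in> children u \<and> pref c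
    else SOME c. c \<in> children u)" for u
  have f_child: "f u \<in> children u" if "children u \<noteq> {}" for u
  proof (cases "\<exists>c\<in>children u. pref c")
    case True
    then have "\<exists>c. c \<in> children u \<and> pref c" by blast
    from someI_ex[OF this] True show ?thesis unfolding f_def by simp
  next
    case False
    then show ?thesis using that someI_ex[of "\<lambda>c. c \<in> children u"] by (auto simp: f_def)
  qed
  have f_pref: "pref (f u)" if "\<exists>c\<in>children u. pref c" for u
  proof -
    from that have "\<exists>c. c \<in> children u \<and> pref c" by blast
    from someI_ex[OF this] that show ?thesis unfolding f_def by simp
  qed
  define x where "x i = (f ^^ i) r" for i
  have x0: "x 0 = r" and xS: "x (Suc i) = f (x i)" for i by (auto simp: x_def)
  have pref: "pref (x i) \<and> depth (x i) = i \<and> x i \<in> pverts T \<and>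
      (i < depth v \<longrightarrow> children (x i) \<noteq> {})" if "i \<le> depth v" for i
    using that
  proof (induction i)
    case 0
    then show ?case using root_in_verts children_root_nonempty by (simp add: x0 pref_def)
  next
    case (Suc i)
    have *: "\<exists>c\<in>children u. pref c" if u: "pref u" "u \<in> pverts T" "depth u < depth v" for u
    proof -
      obtain t where t: "walk_to u @ t = walk_to v" using u(1) by (auto simp: pref_def)
      then obtain e t' where t': "t = e # t'" using u(3) by (cases t) (auto simp: depth_def)
      have e: "awalk r (walk_to u @ e # t') v" using awalk_walk_to[OF assms] t t' by simp
      then have "awalk r (walk_to u) (fst e)" by (auto simp: awalk_simps)
      then have "walk_to (fst e) = walk_to u" "fst e \<in> pverts T"
        by (rule walk_to_eqI, rule awalk_last_in_verts)
      then have "fst e = u" using walk_to_inj u(2) by blast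
      then have "(u, snd e) \<in> parcs T" using e by (auto simp: awalk_simps)
      then have "snd e \<in> children u" "walk_to (snd e) = walk_to u @ [e]"
        using walk_to_arc \<open>fst e = u\<close> by (auto simp: children_def)
      moreover have "pref (snd e)" unfolding pref_def using calculation t t' by auto
      ultimately show ?thesis by blast
    qed
    from Suc have i: "pref (x i)" "depth (x i) = i" "x i \<in> pverts T" "children (x i) \<noteq> {}" by auto
    then have "pref (x (Suc i))" using *[of "x i"] Suc.prems f_pref xS by simp
    moreover have "x (Suc i) \<in> children (x i)" using f_child i xS by simp
    ultimately show ?case using *[of "x (Suc i)"] i in_childrenD[of "x (Suc i)" "x i"] by auto
  qed
  have xv: "x (depth v) = v"
  proof -
    from pref[of "depth v"] obtain t where "walk_to (x (depth v)) @ t = walk_to v"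
      "depth (x (depth v)) = depth v" "x (depth v) \<in> pverts T" by (auto simp: pref_def)
    then have "walk_to (x (depth v)) = walk_to v"
      unfolding depth_def by (metis append_Nil2 append_eq_append_conv)
    then show ?thesis using walk_to_inj assms \<open>x (depth v) \<in> pverts T\<close> by blast
  qed
  show ?thesis
  proof (cases "\<forall>i. children (x i) \<noteq> {}")
    case True
    define \<sigma> where "\<sigma> = Infinite_path (\<lambda>i. (x i, x (Suc i)))"
    have "\<sigma> \<in> boundary T r" unfolding \<sigma>_def
      using True f_child xS x0 by (intro infinite_path_in_boundary) auto
    moreover have "x i \<in> path_verts \<sigma>" for i
      by (cases i) (auto simp: x0 path_verts_def \<sigma>_def image_image)
    ultimately show ?thesis using that xv by metis
  next
    case False
    \<comment> \<open>The first childless vertex of the descent; it does not come before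
      \<open>v\<close>, because up to \<open>v\<close> the descent finds children.\<close>
    define k where "k = (LEAST i. children (x i) = {})"
    have k: "children (x k) = {}" unfolding k_def
      using False LeastI_ex[of "\<lambda>i. children (x i) = {}"] by blast
    have below: "children (x i) \<noteq> {}" if "i < k" for i using not_less_Least that k_def by auto
    have kv: "depth v \<le> k" using pref[of k] k by (cases "k < depth v") auto
    have xk: "x i \<in> pverts T \<and> walk_to (x i) = map (\<lambda>i. (x i, x (Suc i))) [0..<i]" if "i \<le> k" for i
      using that
    proof (induction i)
      case 0
      then show ?case using root_in_verts by (simp add: x0)
    next
      case (Suc i)
      then have "x (Suc i) \<in> children (x i)" using below f_child xS by auto
      then show ?case using Suc walk_to_arc[of "x i" "x (Suc i)"] in_childrenD[of "x (Suc i)" "x i"] by auto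
    qed
    have "x k \<noteq> r" using k children_root_nonempty by auto
    then have "leaf T r (x k)" using xk[of k] k by (simp add: leaf_iff)
    then have "Finite_path (walk_to (x k)) \<in> boundary T r"
      using awalk_walk_to[of "x k"] xk[of k] finite_path_in_boundary by blast
    moreover have "v \<in> path_verts (Finite_path (walk_to (x k)))"
    proof (cases "depth v")
      case 0
      then have "v = r" using xv x0 by simp
      then show ?thesis by simp
    next
      case (Suc j)
      then have "(x j, x (Suc j)) \<in> set (walk_to (x k))" using xk[of k] kv by simp
      then have "(x j, v) \<in> set (walk_to (x k))" using xv Suc by simp
      then have "v \<in> snd ` set (walk_to (x k))" by (rule rev_image_eqI) simp
      then show ?thesis by (simp only: path_verts_def path_arcs.simps insert_iff simp_thms)
    qed
    ultimately show ?thesis by (rule that)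
  qed
qed

end

section \<open>Escape probabilities and their flow\<close>

context weighted_tree
begin

section \<open>Conductances and transition probabilities\<close>

definition cond_sum :: "'a \<Rightarrow> real" where
  "cond_sum v = (\<Sum>w\<in>neighbours T v. conductance T l v w)"

abbreviation tp :: "'a \<Rightarrow> 'a \<Rightarrow> real" where
  "tp \<equiv> transition_prob T l"

lemma neighbours_root: "neighbours T r = children r"
  using no_arc_to_root by (auto simp: neighbours_def children_def)

lemma neighbours_nonroot:
  assumes "v \<in> pverts T" "v \<noteq> r"
  shows "neighbours T v = insert (parent v) (children v)"
  using parent_arc[OF assms] by (auto simp: neighbours_def children_def dest: parent_eq)

lemma parent_notin_children: "v \<in> pverts T \<Longrightarrow> v \<noteq> r \<Longrightarrow> parent v \<notin> children v"
  using parent_arc no_reverse_arc by (auto simp: children_def)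

lemma finite_neighbours: "v \<in> pverts T \<Longrightarrow> finite (neighbours T v)"
  by (cases "v = r") (auto simp: neighbours_root neighbours_nonroot)

lemma neighbours_in_verts: "neighbours T v \<subseteq> pverts T"
  by (auto simp: neighbours_def dest: arc_in_verts)

lemma conductance_child: "c \<in> children v \<Longrightarrow> conductance T l v c = 1 / len c"
  using len_child[of c v] by (simp add: conductance_def children_def)

lemma conductance_parent:
  assumes "v \<in> pverts T" "v \<noteq> r"
  shows "conductance T l v (parent v) = 1 / len v"
  using parent_arc[OF assms] no_reverse_arc by (simp add: conductance_def len_def)

lemma conductance_pos:
  assumes "v \<in> pverts T" "w \<in> neighbours T v"
  shows "0 < conductance T l v w"
proof (cases "w \<in> children v")
  case True
  then show ?thesis using conductance_child len_child_pos by simp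
next
  case False
  then have "v \<noteq> r" "w = parent v"
    using assms neighbours_root neighbours_nonroot by auto
  then show ?thesis using conductance_parent len_pos assms by simp
qed

lemma neighbours_nonempty: "v \<in> pverts T \<Longrightarrow> neighbours T v \<noteq> {}"
  using children_root_nonempty by (cases "v = r") (auto simp: neighbours_root neighbours_nonroot)

lemma cond_sum_pos: "v \<in> pverts T \<Longrightarrow> 0 < cond_sum v"
  unfolding cond_sum_def
  using finite_neighbours neighbours_nonempty conductance_pos by (intro sum_pos) auto

lemma tp_eq: "tp v w = conductance T l v w / cond_sum v"
  by (simp add: transition_prob_def cond_sum_def)

lemma tp_nonneg: "v \<in> pverts T \<Longrightarrow> w \<in> neighbours T v \<Longrightarrow> 0 \<le> tp v w"
  using conductance_pos[of v w] cond_sum_pos[of v] by (simp add: tp_eq less_imp_le)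

lemma sum_tp: "v \<in> pverts T \<Longrightarrow> (\<Sum>w\<in>neighbours T v. tp v w) = 1"
  using cond_sum_pos[of v] by (simp add: tp_eq flip: sum_divide_distrib) (simp add: cond_sum_def)

text \<open>\<open>avoid m v\<close> is the probability that the walk from \<open>v\<close> is not at the root at times \<open>1, ..., m\<close>.\<close>

primrec avoid :: "nat \<Rightarrow> 'a \<Rightarrow> real" where
  "avoid 0 v = 1"
| "avoid (Suc m) v = (\<Sum>w\<in>neighbours T v. tp v w * (if w = r then 0 else avoid m w))"

text \<open>Time 0 counts here as well, so the potential vanishes at the root, whereas
  \<open>avoid m r\<close> is the probability of no return up to time \<open>m\<close>.\<close>

definition pot :: "nat \<Rightarrow> 'a \<Rightarrow> real" where
  "pot m v = (if v = r then 0 else avoid m v)"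

lemma avoid_Suc: "avoid (Suc m) v = (\<Sum>w\<in>neighbours T v. tp v w * pot m w)"
  by (simp add: pot_def)

lemma pot_root [simp]: "pot m r = 0"
  by (simp add: pot_def)

lemma avoid_bounds: "v \<in> pverts T \<Longrightarrow> 0 \<le> avoid m v \<and> avoid m v \<le> 1"
proof (induction m arbitrary: v)
  case (Suc m)
  have p: "0 \<le> pot m w \<and> pot m w \<le> 1" if "w \<in> neighbours T v" for w
    using Suc.IH[of w] neighbours_in_verts that by (auto simp: pot_def)
  have "0 \<le> avoid (Suc m) v"
    unfolding avoid_Suc using p tp_nonneg[OF Suc.prems] by (intro sum_nonneg mult_nonneg_nonneg) auto
  moreover have "avoid (Suc m) v \<le> (\<Sum>w\<in>neighbours T v. tp v w)"
    unfolding avoid_Suc using p tp_nonneg[OF Suc.prems] by (intro sum_mono mult_left_le) auto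
  ultimately show ?case using sum_tp[OF Suc.prems] by simp
qed simp

lemma pot_bounds: "v \<in> pverts T \<Longrightarrow> 0 \<le> pot m v" "v \<in> pverts T \<Longrightarrow> pot m v \<le> 1"
  using avoid_bounds by (auto simp: pot_def)

lemma avoid_decreasing: "v \<in> pverts T \<Longrightarrow> avoid (Suc m) v \<le> avoid m v"
proof (induction m arbitrary: v)
  case 0
  show ?case using avoid_bounds[OF 0, of "Suc 0"] by simp
next
  case (Suc m)
  have "pot (Suc m) w \<le> pot m w" if "w \<in> neighbours T v" for w
    using Suc.IH[of w] neighbours_in_verts that by (auto simp: pot_def)
  then show ?case
    unfolding avoid_Suc[of "Suc m"] avoid_Suc[of m]
    using tp_nonneg[OF Suc.prems] by (intro sum_mono mult_left_mono)
qed

lemma pot_decreasing: "v \<in> pverts T \<Longrightarrow> pot (Suc m) v \<le> pot m v"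
  using avoid_decreasing by (simp add: pot_def del: avoid.simps)

text \<open>A walk from a child reaches the root only through the parent. In the induction, every
  neighbour of \<open>c\<close> is \<open>v\<close> or a child of \<open>c\<close>, so all values
  averaged in \<open>pot (Suc m) c\<close> are at least \<open>pot m v\<close>, which is at least
  \<open>pot (Suc m) v\<close>.\<close>

lemma pot_parent_le: "v \<in> pverts T \<Longrightarrow> c \<in> children v \<Longrightarrow> pot m v \<le> pot m c"
proof (induction m arbitrary: v c)
  case 0
  then show ?case using in_childrenD by (auto simp: pot_def)
next
  case (Suc m)
  note c = in_childrenD[OF Suc.prems(2)]
  have "pot m v \<le> pot m w" if w: "w \<in> neighbours T c" for w
  proof -
    have "w = v \<or> w \<in> children c" using w c(4,5) neighbours_nonroot[OF c(3,4)] by auto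
    then show ?thesis using Suc.IH[of v c] Suc.IH[of c w] Suc.prems c(3) by fastforce
  qed
  then have "(\<Sum>w\<in>neighbours T c. tp c w * pot m v) \<le> avoid (Suc m) c"
    unfolding avoid_Suc using tp_nonneg[OF c(3)] by (intro sum_mono mult_left_mono)
  then have "pot m v \<le> pot (Suc m) c"
    using sum_tp[OF c(3)] c(4) by (simp add: pot_def flip: sum_distrib_right del: avoid.simps)
  then show ?case using pot_decreasing[OF Suc.prems(1), of m] by linarith
qed

text \<open>The root cannot be reached in \<open>m\<close> steps from a depth greater than
  \<open>m\<close>. This allows the lower bound to be computed on finitely many levels.\<close>

lemma pot_deep: "v \<in> pverts T \<Longrightarrow> m < depth v \<Longrightarrow> pot m v = 1"
proof (induction m arbitrary: v)
  case 0
  then show ?case by (auto simp: pot_def)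
next
  case (Suc m)
  then have "v \<noteq> r" by auto
  have "pot m w = 1" if w: "w \<in> neighbours T v" for w
  proof -
    have "m < depth w"
      using w neighbours_nonroot[OF Suc.prems(1) \<open>v \<noteq> r\<close>] Suc.prems(2)
        depth_arc[OF parent_arc[OF Suc.prems(1) \<open>v \<noteq> r\<close>]] in_childrenD(6)[of w v] by auto
    then show ?thesis using Suc.IH w neighbours_in_verts by auto
  qed
  then have "avoid (Suc m) v = (\<Sum>w\<in>neighbours T v. tp v w)" unfolding avoid_Suc by simp
  then show ?case using sum_tp[OF Suc.prems(1)] \<open>v \<noteq> r\<close> by (simp add: pot_def)
qed

section \<open>The limiting potential\<close>

definition escape :: "'a \<Rightarrow> real" where
  "escape v = (INF m. avoid m v)"

text \<open>This is the function \<open>h\<close> of the introduction. It differs from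
  \<open>escape\<close> at most at the root, where \<open>escape\<close> is the probability of no
  return.\<close>

definition lpot :: "'a \<Rightarrow> real" where
  "lpot v = (if v = r then 0 else escape v)"

lemma avoid_tendsto: "v \<in> pverts T \<Longrightarrow> (\<lambda>m. avoid m v) \<longlonglongrightarrow> escape v"
  unfolding escape_def
  by (rule LIMSEQ_decseq_INF)
    (use avoid_bounds avoid_decreasing in \<open>auto intro!: bdd_belowI[of _ 0] decseq_SucI simp del: avoid.simps\<close>)

lemma pot_tendsto: "v \<in> pverts T \<Longrightarrow> (\<lambda>m. pot m v) \<longlonglongrightarrow> lpot v"
  using avoid_tendsto by (simp add: pot_def lpot_def)

lemma lpot_root [simp]: "lpot r = 0"
  by (simp add: lpot_def)

lemma lpot_bounds: "v \<in> pverts T \<Longrightarrow> 0 \<le> lpot v" "v \<in> pverts T \<Longrightarrow> lpot v \<le> 1"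
  using pot_bounds by (auto intro: LIMSEQ_le_const[OF pot_tendsto] LIMSEQ_le_const2[OF pot_tendsto])

lemma lpot_parent_le: "c \<in> children v \<Longrightarrow> lpot v \<le> lpot c"
  using pot_parent_le in_childrenD(2,3) by (blast intro: LIMSEQ_le[OF pot_tendsto pot_tendsto])

text \<open>The recursion of \<open>avoid\<close> passes to the limit, the neighbour sets being
  finite. Off the root this is harmonicity of \<open>lpot\<close>; at the root it computes the
  probability of no return.\<close>

lemma escape_eq: 
  assumes "v \<in> pverts T"
  shows "escape v = (\<Sum>w\<in>neighbours T v. tp v w * lpot w)"
proof (rule LIMSEQ_unique)
  show "(\<lambda>m. avoid (Suc m) v) \<longlonglongrightarrow> escape v" using avoid_tendsto[OF assms] by (rule LIMSEQ_Suc)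
  show "(\<lambda>m. avoid (Suc m) v) \<longlonglongrightarrow> (\<Sum>w\<in>neighbours T v. tp v w * lpot w)"
    unfolding avoid_Suc using neighbours_in_verts
    by (intro tendsto_sum tendsto_mult tendsto_const pot_tendsto) auto
qed

text \<open>Ohm's law: the current through the arc that ends at \<open>v\<close>. A vertex other
  than the root has exactly one incoming arc, so arcs are indexed by their heads.\<close>

definition flow :: "('a \<Rightarrow> real) \<Rightarrow> 'a \<Rightarrow> real" where
  "flow f v = (f v - f (parent v)) / len v"

definition outflow :: "('a \<Rightarrow> real) \<Rightarrow> 'a \<Rightarrow> real" where
  "outflow f v = (\<Sum>c\<in>children v. flow f c)"

lemma outflow_root:
  assumes "f r = 0"
  shows "outflow f r = cond_sum r * (\<Sum>w\<in>neighbours T r. tp r w * f w)"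
  unfolding outflow_def neighbours_root sum_distrib_left
  using cond_sum_pos[OF root_in_verts] assms
  by (intro sum.cong) (auto simp: flow_def tp_eq conductance_child in_childrenD)

text \<open>The right-hand side is the weighted Laplacian of \<open>f\<close>, so harmonicity at
  \<open>v\<close> is Kirchhoff's node law. The split of the neighbours into parent and children
  gives the two terms on the left.\<close>

lemma outflow_nonroot:
  assumes "v \<in> pverts T" "v \<noteq> r"
  shows "outflow f v - flow f v = cond_sum v * ((\<Sum>w\<in>neighbours T v. tp v w * f w) - f v)"
proof -
  have pos: "0 < cond_sum v" by (rule cond_sum_pos[OF assms(1)])
  have "(\<Sum>w\<in>neighbours T v. tp v w * f w) - f v = (\<Sum>w\<in>neighbours T v. tp v w * (f w - f v))"
    using sum_tp[OF assms(1)] by (simp add: right_diff_distrib sum_subtractf flip: sum_distrib_right)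
  also have "cond_sum v * \<dots> = (\<Sum>w\<in>neighbours T v. conductance T l v w * (f w - f v))"
    using pos by (simp add: sum_distrib_left tp_eq)
  also have "\<dots> = conductance T l v (parent v) * (f (parent v) - f v)
      + (\<Sum>w\<in>children v. conductance T l v w * (f w - f v))"
    unfolding neighbours_nonroot[OF assms]
    using parent_notin_children[OF assms] by simp
  also have "(\<Sum>w\<in>children v. conductance T l v w * (f w - f v)) = outflow f v"
    unfolding outflow_def by (intro sum.cong) (auto simp: flow_def conductance_child in_childrenD)
  also have "conductance T l v (parent v) * (f (parent v) - f v) = - flow f v"
    using conductance_parent[OF assms] by (simp add: flow_def diff_divide_distrib)
  finally show ?thesis by simp
qed

text \<open>The average of \<open>pot m\<close> around \<open>v\<close> is
  \<open>avoid (Suc m) v\<close>, which is at most \<open>avoid m v\<close>. Thus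
  \<open>pot m\<close> is superharmonic off the root and its current can only be lost on the way
  down.\<close>

lemma outflow_pot_le:
  assumes "v \<in> pverts T" "v \<noteq> r"
  shows "outflow (pot m) v \<le> flow (pot m) v"
proof -
  have "(\<Sum>w\<in>neighbours T v. tp v w * pot m w) \<le> pot m v"
    using pot_decreasing[OF assms(1), of m] assms(2)
    by (simp add: pot_def[of "Suc m"] avoid_Suc del: avoid.simps)
  then have "cond_sum v * ((\<Sum>w\<in>neighbours T v. tp v w * pot m w) - pot m v) \<le> 0"
    using cond_sum_pos[OF assms(1)] by (simp add: mult_le_0_iff)
  then show ?thesis using outflow_nonroot[OF assms, of "pot m"] by linarith
qed

lemma outflow_lpot_eq:
  assumes "v \<in> pverts T" "v \<noteq> r"
  shows "outflow lpot v = flow lpot v"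
  using outflow_nonroot[OF assms, of lpot] escape_eq[OF assms(1)] assms(2) by (simp add: lpot_def[of v])

lemma outflow_lpot_root: "outflow lpot r = cond_sum r * escape r"
  by (simp add: outflow_root escape_eq root_in_verts)

lemma outflow_pot_root: "outflow (pot m) r = cond_sum r * avoid (Suc m) r"
  by (simp only: outflow_root pot_root avoid_Suc)

lemma outflow_pot_root_tendsto: "(\<lambda>m. outflow (pot m) r) \<longlonglongrightarrow> outflow lpot r"
  unfolding outflow_lpot_root outflow_pot_root
  by (intro tendsto_mult tendsto_const LIMSEQ_Suc avoid_tendsto root_in_verts)

lemma flow_nonneg:
  assumes "c \<in> children v" "f v \<le> f c"
  shows "0 \<le> flow f c"
  using assms len_child_pos[OF assms(1)] in_childrenD(5)[OF assms(1)] by (simp add: flow_def)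

end

section \<open>Upper bound for the factorials\<close>

locale factorial_sequence = weighted_tree T r l
  for T :: "'a pair_pre_digraph" and r :: 'a and l :: "'a \<times> 'a \<Rightarrow> real" +
  fixes \<rho> :: "nat \<Rightarrow> 'a root_path"
  assumes weakly_complete: "weakly_complete T l"
    and minimizing: "minimizing_sequence T r l \<rho>"
begin

abbreviation fact_seq :: "nat \<Rightarrow> real" where
  "fact_seq \<equiv> tree_factorial l \<rho>"

lemma rho_boundary: "\<rho> n \<in> boundary T r"
  using minimizing by (simp add: minimizing_sequence_def is_arg_min_def)

lemma rho_distinct: "j < n \<Longrightarrow> \<rho> n \<noteq> \<rho> j"
  using minimizing by (auto simp: minimizing_sequence_def is_arg_min_def)

lemma inj_rho: "inj \<rho>"
  by (rule linorder_injI) (use rho_distinct in force)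

text \<open>The minimality of the choices enters here: to bound a factorial from above it suffices
  to exhibit one path that is not among the earlier ones.\<close>

lemma fact_seq_le:
  assumes "\<sigma> \<in> boundary T r" "\<sigma> \<notin> \<rho> ` {..<n}"
  shows "fact_seq n \<le> (\<Sum>j<n. pairing l \<sigma> (\<rho> j))"
proof -
  have "\<not> (\<Sum>j<n. pairing l \<sigma> (\<rho> j)) < (\<Sum>j<n. pairing l (\<rho> n) (\<rho> j))"
    using minimizing assms unfolding minimizing_sequence_def is_arg_min_def by blast
  then show ?thesis by (simp add: tree_factorial_def)
qed

text \<open>If each of the first \<open>n\<close> chosen paths carries one unit, this is the flow
  through the arc into \<open>v\<close>.\<close>

definition visits :: "nat \<Rightarrow> 'a \<Rightarrow> nat" where
  "visits n v = card {j. j < n \<and> v \<in> path_verts (\<rho> j)}"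

lemma visits_root [simp]: "visits n r = n"
  by (simp add: visits_def)

lemma visits_le: "visits n v \<le> n"
proof -
  have "visits n v \<le> card {..<n}" unfolding visits_def by (intro card_mono) auto
  then show ?thesis by simp
qed

lemma visits_eq_sum: "real (visits n v) = (\<Sum>j<n. if v \<in> path_verts (\<rho> j) then 1 else 0)"
proof -
  have "{j. j < n \<and> v \<in> path_verts (\<rho> j)} = {j \<in> {..<n}. v \<in> path_verts (\<rho> j)}" by auto
  then show ?thesis unfolding visits_def by (simp add: sum.If_cases Int_def)
qed

text \<open>A path through a child passes \<open>v\<close> and no other child. Paths that end at
  \<open>v\<close> are lost, hence the inequality.\<close>

lemma sum_visits_children: "(\<Sum>c\<in>children v. visits n c) \<le> visits n v"
proof -
  let ?J = "\<lambda>v. {j. j < n \<and> v \<in> path_verts (\<rho> j)}"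
  have "(\<Sum>c\<in>children v. card (?J c)) = card (\<Union>c\<in>children v. ?J c)"
  proof (rule card_UN_disjoint[symmetric])
    show "\<forall>c\<in>children v. \<forall>c'\<in>children v. c \<noteq> c' \<longrightarrow> ?J c \<inter> ?J c' = {}"
      using path_verts_inj_depth[OF rho_boundary] in_childrenD(6) by fastforce
  qed auto
  also have "\<dots> \<le> card (?J v)"
  proof (rule card_mono)
    show "(\<Union>c\<in>children v. ?J c) \<subseteq> ?J v"
      using parent_in_path_verts[OF rho_boundary] in_childrenD(1) by blast
  qed auto
  finally show ?thesis by (simp add: visits_def)
qed

lemma sum_visits_children_real: "(\<Sum>c\<in>children v. real (visits n c)) \<le> real (visits n v)"
  using sum_visits_children[of n v] by (metis of_nat_mono of_nat_sum)

section \<open>Infinite paths as sequences of vertices\<close>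

definition ray :: "(nat \<Rightarrow> 'a) \<Rightarrow> bool" where
  "ray x \<longleftrightarrow> x 0 = r \<and> (\<forall>i. x (Suc i) \<in> children (x i))"

lemma ray_depth: "ray x \<Longrightarrow> depth (x i) = i"
proof (induction i)
  case (Suc i)
  then have "x (Suc i) \<in> children (x i)" by (simp add: ray_def)
  then show ?case using in_childrenD(6) Suc by simp
qed (simp add: ray_def)

lemma ray_len:
  assumes "ray x"
  shows "l (x i, x (Suc i)) = len (x (Suc i))" "0 \<le> len (x (Suc i))"
proof -
  have "x (Suc i) \<in> children (x i)" using assms by (simp add: ray_def)
  then show "l (x i, x (Suc i)) = len (x (Suc i))" "0 \<le> len (x (Suc i))"
    using len_child[of "x (Suc i)" "x i"] len_child_pos[of "x (Suc i)" "x i"] by simp_all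
qed

lemma ray_verts: "ray x \<Longrightarrow> x i \<in> pverts T"
  by (cases i) (auto simp: ray_def root_in_verts dest: in_childrenD)

lemma ray_boundary: "ray x \<Longrightarrow> Infinite_path (\<lambda>i. (x i, x (Suc i))) \<in> boundary T r"
  by (rule infinite_path_in_boundary) (auto simp: ray_def)

lemma ray_path_verts: "ray x \<Longrightarrow> x i \<in> path_verts (Infinite_path (\<lambda>i. (x i, x (Suc i))))"
  by (cases i) (auto simp: ray_def path_verts_def image_image)

lemma ray_arc: "ray x \<Longrightarrow> (x i, x (Suc i)) \<in> parcs T"
  by (auto simp: ray_def children_def)

text \<open>Exchanging the sums counts each arc with the number of chosen paths through it. The path
  \<open>\<sigma>\<close> may leave the ray; only the arcs it shares with chosen paths have to lie
  on the initial part of the ray.\<close>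

lemma sum_pairing_le_along_ray:
  assumes x: "ray x"
    and sub: "\<And>j. j < n \<Longrightarrow> path_arcs \<sigma> \<inter> path_arcs (\<rho> j) \<subseteq> (\<lambda>i. (x i, x (Suc i))) ` {..<K}"
  shows "(\<Sum>j<n. pairing l \<sigma> (\<rho> j)) \<le> (\<Sum>i<K. len (x (Suc i)) * visits n (x (Suc i)))"
proof -
  let ?q = "\<lambda>i. (x i, x (Suc i))"
  have inj: "inj ?q" using ray_depth[OF x] by (metis (no_types, lifting) injI prod.inject)
  have lenq: "l (?q i) = len (x (Suc i))" for i by (rule ray_len[OF x])
  note len_ge = ray_len(2)[OF x]
  have "pairing l \<sigma> (\<rho> j) \<le> (\<Sum>i<K. len (x (Suc i)) * (if x (Suc i) \<in> path_verts (\<rho> j) then 1 else 0))"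
    if j: "j < n" for j
  proof -
    have "pairing l \<sigma> (\<rho> j) \<le> sum l (?q ` {..<K} \<inter> path_arcs (\<rho> j))"
      unfolding pairing_def
      by (rule sum_mono2) (use sub[OF j] lenq len_ge in auto)
    also have "?q ` {..<K} \<inter> path_arcs (\<rho> j) = ?q ` {i \<in> {..<K}. ?q i \<in> path_arcs (\<rho> j)}" by auto
    also have "sum l \<dots> = (\<Sum>i\<in>{i \<in> {..<K}. ?q i \<in> path_arcs (\<rho> j)}. len (x (Suc i)))"
      using inj lenq by (subst sum.reindex) (auto simp: inj_on_def)
    also have "\<dots> = (\<Sum>i<K. if ?q i \<in> path_arcs (\<rho> j) then len (x (Suc i)) else 0)"
      by (rule sum.inter_filter) simp
    also have "\<dots> = (\<Sum>i<K. len (x (Suc i)) * (if x (Suc i) \<in> path_verts (\<rho> j) then 1 else 0))"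
      using head_in_path_verts_iff[OF rho_boundary ray_arc[OF x]] by (intro sum.cong) auto
    finally show ?thesis .
  qed
  then have "(\<Sum>j<n. pairing l \<sigma> (\<rho> j))
    \<le> (\<Sum>j<n. \<Sum>i<K. len (x (Suc i)) * (if x (Suc i) \<in> path_verts (\<rho> j) then 1 else 0))"
    by (intro sum_mono) simp
  also have "\<dots> = (\<Sum>i<K. len (x (Suc i)) * visits n (x (Suc i)))"
    unfolding visits_eq_sum sum_distrib_left by (rule sum.swap)
  finally show ?thesis .
qed

text \<open>
  Method of conditional expectations for a path drawn from the normalised current of \<open>lpot\<close>:
  \<open>outflow lpot v * a + visits n v * (1 - lpot v)\<close> bounds the contribution of the paths through
  \<open>v\<close> to the expected value, \<open>a\<close> being the part collected before \<open>v\<close>.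
\<close>

lemma descent_step:
  assumes v: "v \<in> pverts T" and pos: "0 < outflow lpot v"
    and le: "outflow lpot v * a + visits n v * (1 - lpot v) \<le> B * outflow lpot v"
  shows "\<exists>c\<in>children v. 0 < outflow lpot c \<and>
    outflow lpot c * (a + len c * visits n c) + visits n c * (1 - lpot c) \<le> B * outflow lpot c"
\<comment> \<open>If every child with positive current violated its inequality, the sum over the
  children would violate the one at \<open>v\<close>.\<close>
proof (rule ccontr)
  assume contra: "\<not> ?thesis"
  have fl: "outflow lpot c = flow lpot c" "0 \<le> flow lpot c" "flow lpot c * len c = lpot c - lpot v"
    "lpot c \<le> 1" if "c \<in> children v" for c
    using that outflow_lpot_eq flow_nonneg[OF that lpot_parent_le[OF that]] in_childrenD[OF that]
      len_child_pos[OF that] lpot_bounds by (auto simp: flow_def)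
  let ?Q = "\<lambda>c. flow lpot c * (a + len c * visits n c) + visits n c * (1 - lpot c)"
  have "(\<Sum>c\<in>children v. ?Q c) = (\<Sum>c\<in>children v. a * flow lpot c + real (visits n c) * (1 - lpot v))"
  proof (rule sum.cong[OF refl])
    \<comment> \<open>Current times length is the increment of \<open>lpot\<close> along the arc, so
      \<open>lpot c\<close> cancels.\<close>
    fix c assume "c \<in> children v"
    have "?Q c = a * flow lpot c + real (visits n c) * (flow lpot c * len c + (1 - lpot c))"
      by (simp add: algebra_simps)
    then show "?Q c = a * flow lpot c + real (visits n c) * (1 - lpot v)"
      using fl(3)[OF \<open>c \<in> children v\<close>] by simp
  qed
  also have "\<dots> = a * outflow lpot v + (\<Sum>c\<in>children v. real (visits n c)) * (1 - lpot v)"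
    by (simp add: sum.distrib outflow_def sum_distrib_left sum_distrib_right)
  also have "\<dots> \<le> a * outflow lpot v + visits n v * (1 - lpot v)"
    using sum_visits_children_real[of n v] lpot_bounds(2)[OF v] by (intro add_left_mono mult_right_mono) auto
  also have "\<dots> \<le> B * outflow lpot v" using le by (simp add: mult.commute)
  also have "\<dots> = (\<Sum>c\<in>children v. B * flow lpot c)" by (simp add: outflow_def sum_distrib_left)
  finally have 1: "(\<Sum>c\<in>children v. ?Q c) \<le> (\<Sum>c\<in>children v. B * flow lpot c)" .
  \<comment> \<open>A child without current satisfies the weak inequality because
    \<open>lpot c\<close> is at most 1; strictness is needed at one child only.\<close>
  have ge: "B * flow lpot c \<le> ?Q c \<and> (0 < flow lpot c \<longrightarrow> B * flow lpot c < ?Q c)"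
    if c: "c \<in> children v" for c
  proof (cases "flow lpot c = 0")
    case True
    then show ?thesis using fl[OF c] by simp
  next
    case False
    then have "0 < outflow lpot c" using fl[OF c] by simp
    then have "\<not> ?Q c \<le> B * flow lpot c" using contra c fl(1)[OF c] by auto
    then show ?thesis by linarith
  qed
  obtain c where c: "c \<in> children v" "0 < flow lpot c"
    using pos unfolding outflow_def by (meson not_less sum_nonpos)
  have "(\<Sum>c\<in>children v. B * flow lpot c) < (\<Sum>c\<in>children v. ?Q c)"
    by (rule sum_strict_mono_ex1) (use ge c in auto)
  with 1 show False by linarith
qed

text \<open>Iteration of \<open>descent_step\<close> from the root, on pairs of a vertex and the
  weighted length collected so far. The outflow stays positive, so the descent never ends at a
  leaf.\<close>

lemma descent:
  assumes s: "0 < outflow lpot r"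
  obtains x where "ray x"
    "\<And>k. (\<Sum>i<k. len (x (Suc i)) * visits n (x (Suc i))) \<le> n / outflow lpot r"
proof -
  define B where "B = n / outflow lpot r"
  define P where "P = (\<lambda>(v, a). v \<in> pverts T \<and> 0 < outflow lpot v \<and>
    outflow lpot v * a + visits n v * (1 - lpot v) \<le> B * outflow lpot v)"
  define R where "R = (\<lambda>(v, a) (c, a'). c \<in> children v \<and> a' = a + len c * real (visits n c))"
  have step: "\<exists>y. P y \<and> R z y" if "P z" for z
  proof -
    obtain v a where z: "z = (v, a)" by (cases z)
    from that descent_step[of v a n B] obtain c where "c \<in> children v" "0 < outflow lpot c"
      "outflow lpot c * (a + len c * visits n c) + visits n c * (1 - lpot c) \<le> B * outflow lpot c"
      by (auto simp: P_def z)
    then have "P (c, a + len c * visits n c) \<and> R z (c, a + len c * visits n c)"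
      using in_childrenD(3) by (auto simp: P_def R_def z)
    then show ?thesis by blast
  qed
  \<comment> \<open>At the root the invariant is an equality, because \<open>visits n r = n\<close>
    and \<open>lpot r = 0\<close>; this fixes \<open>B\<close>.\<close>
  have P0: "P (r, 0)" using s root_in_verts by (simp add: P_def B_def)
  obtain f where f: "f 0 = (r, 0)" "\<And>k. P (f k)" "\<And>k. R (f k) (f (Suc k))"
  proof -
    have "\<exists>f. \<forall>k. (P (f k) \<and> (k = 0 \<longrightarrow> f k = (r, 0))) \<and> R (f k) (f (Suc k))"
      by (rule dependent_nat_choice) (use P0 step in auto)
    then show ?thesis using that by metis
  qed
  define x where "x = fst \<circ> f"
  have "ray x" using f(1,3) by (auto simp: ray_def x_def R_def split_beta)
  have acc: "snd (f k) = (\<Sum>i<k. len (x (Suc i)) * visits n (x (Suc i)))" for k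
    by (induction k) (use f(1,3) in \<open>auto simp: x_def R_def split_beta\<close>)
  have "snd (f k) \<le> B" for k
  proof -
    have "x k \<in> pverts T" and pos: "0 < outflow lpot (x k)"
      and le: "outflow lpot (x k) * snd (f k) + visits n (x k) * (1 - lpot (x k)) \<le> B * outflow lpot (x k)"
      using f(2)[of k] by (simp_all add: P_def x_def split_beta)
    then have "0 \<le> visits n (x k) * (1 - lpot (x k))" using lpot_bounds(2) by simp
    with le have "snd (f k) * outflow lpot (x k) \<le> B * outflow lpot (x k)" by (simp add: mult.commute)
    with pos show ?thesis by simp
  qed
  then show ?thesis using that[OF \<open>ray x\<close>] acc by (simp add: B_def)
qed

text \<open>Beyond its last branching vertex a ray would have infinite length by weak
  completeness.\<close>

lemma ray_branches:
  assumes x: "ray x" and bd: "\<And>k. (\<Sum>i<k. len (x (Suc i))) \<le> B"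
  shows "\<exists>i\<ge>K. branching T (x i)"
proof (rule ccontr)
  assume contra: "\<not> ?thesis"
  define p where "p i = (x (i + K), x (Suc (i + K)))" for i
  have lp: "l (p i) = len (x (Suc (i + K)))" for i
    using ray_len(1)[OF x] by (simp add: p_def)
  note len_ge = ray_len(2)[OF x]
  have "infinite_walk T (x K) p" using ray_arc[OF x] by (simp add: infinite_walk_def p_def)
  moreover have "\<not> branching T (snd (p i))" for i using contra by (auto simp: p_def)
  ultimately have "(\<Sum>i. ennreal (l (p i))) = \<infinity>"
    using weakly_complete ray_verts[OF x] unfolding weakly_complete_def by blast
  moreover have "(\<Sum>i. ennreal (l (p i))) \<le> ennreal B"
  proof (rule suminf_le_const)
    fix n
    have "(\<Sum>i<n. l (p i)) = (\<Sum>i\<in>{K..<n + K}. len (x (Suc i)))"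
      unfolding lp using sum.shift_bounds_nat_ivl[of "\<lambda>i. len (x (Suc i))" 0 K n]
      by (simp add: atLeast0LessThan)
    also have "\<dots> \<le> (\<Sum>i<n + K. len (x (Suc i)))"
      using len_ge by (intro sum_mono2) auto
    finally have "(\<Sum>i<n. l (p i)) \<le> B" using bd[of "n + K"] by linarith
    then show "(\<Sum>i<n. ennreal (l (p i))) \<le> ennreal B"
      using len_ge lp by (subst sum_ennreal) (auto simp: ennreal_leI)
  qed simp
  ultimately show False by (simp add: top_unique)
qed

text \<open>
  If the ray found by the descent is one of the paths already chosen, weak completeness allows to
  leave it at a late branching vertex.
\<close>

theorem fact_seq_upper:
  assumes s: "0 < outflow lpot r"
  shows "fact_seq n \<le> n / outflow lpot r"
proof -
  obtain x where x: "ray x"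
    and le: "\<And>k. (\<Sum>i<k. len (x (Suc i)) * visits n (x (Suc i))) \<le> n / outflow lpot r"
    using descent[OF s] by blast
  define q where "q = (\<lambda>i. (x i, x (Suc i)))"
  define \<tau> where "\<tau> = Infinite_path q"
  have tau: "\<tau> \<in> boundary T r" using ray_boundary[OF x] by (simp add: \<tau>_def q_def)
  have x_tau: "x i \<in> path_verts \<tau>" for i using ray_path_verts[OF x] by (simp add: \<tau>_def q_def)
  have qd: "depth (snd (q i)) = Suc i" for i using ray_depth[OF x] by (simp add: q_def)
  have "\<exists>K. \<forall>e \<in> path_arcs \<tau> \<inter> path_arcs (\<rho> j). depth (snd e) \<le> K" if "\<tau> \<noteq> \<rho> j" for j
    using common_arcs_bounded[OF tau rho_boundary that] .
  then obtain Kf where Kf: "\<And>j e. \<tau> \<noteq> \<rho> j \<Longrightarrow> e \<in> path_arcs \<tau> \<inter> path_arcs (\<rho> j) \<Longrightarrow> depth (snd e) \<le> Kf j"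
    by metis
  \<comment> \<open>From position \<open>K\<close> on, no arc of \<open>\<tau>\<close> lies on a
    chosen path different from \<open>\<tau>\<close>. The sum serves as an upper bound for the
    maximum of the \<open>Kf j\<close>.\<close>
  define K where "K = (\<Sum>j<n. Kf j)"
  have K: "i < K" if "j < n" "\<tau> \<noteq> \<rho> j" "q i \<in> path_arcs (\<rho> j)" for i j
  proof -
    have "Suc i \<le> Kf j" using Kf[OF that(2), of "q i"] that(3) qd by (auto simp: \<tau>_def)
    also have "\<dots> \<le> K" unfolding K_def using that(1) by (intro member_le_sum) auto
    finally show ?thesis by simp
  qed
  \<comment> \<open>What a competitor has to satisfy; it is applied to \<open>\<tau>\<close> itself
    or to a path that leaves \<open>\<tau>\<close> late.\<close>
  have good: ?thesis if "\<sigma> \<in> boundary T r" "\<And>j. j < n \<Longrightarrow> \<sigma> \<noteq> \<rho> j"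
    "\<And>j. j < n \<Longrightarrow> path_arcs \<sigma> \<inter> path_arcs (\<rho> j) \<subseteq> q ` {..<k}" for \<sigma> k
  proof -
    have "\<sigma> \<notin> \<rho> ` {..<n}" using that(2) by blast
    from fact_seq_le[OF that(1) this]
    have "fact_seq n \<le> (\<Sum>j<n. pairing l \<sigma> (\<rho> j))" .
    also have "\<dots> \<le> (\<Sum>i<k. len (x (Suc i)) * visits n (x (Suc i)))"
      by (rule sum_pairing_le_along_ray[OF x]) (use that(3) in \<open>simp add: q_def\<close>)
    finally show ?thesis using le[of k] by linarith
  qed
  show ?thesis
  proof (cases "\<tau> \<in> \<rho> ` {..<n}")
    case False
    show ?thesis
    proof (rule good[OF tau])
      fix j assume "j < n"
      then have "q i \<in> path_arcs (\<rho> j) \<Longrightarrow> q i \<in> q ` {..<K}" for i using K[of j i] False by blast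
      then show "path_arcs \<tau> \<inter> path_arcs (\<rho> j) \<subseteq> q ` {..<K}" by (auto simp: \<tau>_def)
    qed (use False in auto)
  next
    case True
    then obtain j0 where j0: "j0 < n" "\<tau> = \<rho> j0" by auto
    \<comment> \<open>Since \<open>\<tau>\<close> is a chosen path, each of its vertices is visited
      at least once, and the weighted bound limits the length of the ray.\<close>
    have "len (x (Suc i)) \<le> len (x (Suc i)) * visits n (x (Suc i))" for i
    proof -
      have "j0 \<in> {j. j < n \<and> x (Suc i) \<in> path_verts (\<rho> j)}" using j0 x_tau by auto
      then have "visits n (x (Suc i)) \<noteq> 0" unfolding visits_def by (subst card_0_eq) auto
      then have "1 \<le> real (visits n (x (Suc i)))" by simp
      from mult_left_mono[OF this ray_len(2)[OF x, of i]] show ?thesis by simp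
    qed
    then have "(\<Sum>i<k. len (x (Suc i))) \<le> n / outflow lpot r" for k
      using le[of k] sum_mono[of "{..<k}" "\<lambda>i. len (x (Suc i))"
        "\<lambda>i. len (x (Suc i)) * visits n (x (Suc i))"] by force
    \<comment> \<open>With \<open>i\<close> at least \<open>Suc K\<close>, the arc into
      \<open>x i\<close> has position at least \<open>K\<close> and lies on no chosen path other
      than \<open>\<tau>\<close>.\<close>
    then obtain i where i: "Suc K \<le> i" "branching T (x i)" using ray_branches[OF x] by blast
    obtain c where c: "c \<in> children (x i)" "c \<noteq> x (Suc i)"
    proof -
      have "2 \<le> card (children (x i))" using i(2) by (simp add: branching_def out_degree_eq)
      then have "\<not> children (x i) \<subseteq> {x (Suc i)}" using card_mono[of "{x (Suc i)}" "children (x i)"] by auto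
      then show ?thesis using that by auto
    qed
    obtain \<sigma> where \<sigma>: "\<sigma> \<in> boundary T r" "c \<in> path_verts \<sigma>"
      using boundary_through in_childrenD(3)[OF c(1)] by blast
    have dc: "depth c = Suc i" using in_childrenD(6)[OF c(1)] ray_depth[OF x] by simp
    have xi: "x i \<in> path_verts \<sigma>" using parent_in_path_verts[OF \<sigma>] in_childrenD(1)[OF c(1)] by blast
    have walk: "set (walk_to (x i)) = q ` {..<i}" for i
    proof (induction i)
      case 0
      then show ?case using x by (simp add: ray_def)
    next
      case (Suc i)
      then show ?case using walk_to_arc[OF ray_arc[OF x, of i]] by (auto simp: q_def lessThan_Suc)
    qed
    have arcs_\<sigma>: "q ` {..<i} = {e \<in> path_arcs \<sigma>. depth (snd e) \<le> i}"
      using walk_to_arcs[OF \<sigma>(1) xi] walk ray_depth[OF x] by simp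
    obtain i' where i': "i = Suc i'" "K \<le> i'" using i(1) by (cases i) auto
    have c_tau: "c \<notin> path_verts \<tau>"
      using path_verts_inj_depth[OF tau _ x_tau, of c "Suc i"] dc ray_depth[OF x] c(2) by auto
    have notin: "x i \<notin> path_verts (\<rho> j)" if "j < n" "\<tau> \<noteq> \<rho> j" for j
      using K[OF that, of i'] i' head_in_path_verts_iff[OF rho_boundary ray_arc[OF x, of i']]
      by (auto simp: q_def)
    show ?thesis
    proof (rule good[OF \<sigma>(1)])
      fix j assume j: "j < n"
      show "\<sigma> \<noteq> \<rho> j" using c_tau \<sigma>(2) notin[OF j] xi by (cases "\<tau> = \<rho> j") auto
      show "path_arcs \<sigma> \<inter> path_arcs (\<rho> j) \<subseteq> q ` {..<i}"
      proof
        fix e assume e: "e \<in> path_arcs \<sigma> \<inter> path_arcs (\<rho> j)"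
        then have es: "snd e \<in> path_verts \<sigma>" "snd e \<in> path_verts (\<rho> j)"
          unfolding path_verts_def by blast+
        \<comment> \<open>A deeper common arc would force \<open>\<rho> j\<close> through both
          \<open>x i\<close> and \<open>c\<close>. The first is impossible if
          \<open>\<rho> j\<close> differs from \<open>\<tau>\<close>, the second if it equals
          \<open>\<tau>\<close>.\<close>
        have "depth (snd e) \<le> i"
        proof (rule ccontr)
          assume "\<not> depth (snd e) \<le> i"
          then have d: "Suc i \<le> depth (snd e)" by simp
          have eq: "{u \<in> path_verts \<sigma>. depth u \<le> depth (snd e)} = {u \<in> path_verts (\<rho> j). depth u \<le> depth (snd e)}"
            using walk_to_verts[OF \<sigma>(1) es(1)] walk_to_verts[OF rho_boundary es(2)] by simp
          have "{c, x i} \<subseteq> {u \<in> path_verts \<sigma>. depth u \<le> depth (snd e)}"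
            using \<sigma>(2) xi d dc ray_depth[OF x, of i] by simp
          then have "c \<in> path_verts (\<rho> j)" "x i \<in> path_verts (\<rho> j)" unfolding eq by simp_all
          then show False using c_tau notin[OF j] by (cases "\<tau> = \<rho> j") auto
        qed
        then show "e \<in> q ` {..<i}" using arcs_\<sigma> e by simp
      qed
    qed
  qed
qed

end

section \<open>Lower bound for the factorials\<close>

context factorial_sequence
begin

lemma pairing_nonneg: "\<sigma> \<in> boundary T r \<Longrightarrow> 0 \<le> pairing l \<sigma> \<tau>"
  unfolding pairing_def using path_arcs_subset[of \<sigma>] length_function
  by (intro sum_nonneg) (auto simp: length_function_def intro: less_imp_le)

lemma fact_seq_nonneg: "0 \<le> fact_seq n"
  unfolding tree_factorial_def by (intro sum_nonneg pairing_nonneg rho_boundary)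

text \<open>The path \<open>\<rho> (Suc n)\<close> was available at step \<open>n\<close>, and its
  pairing with \<open>\<rho> n\<close> is nonnegative.\<close>

lemma fact_seq_mono_Suc: "fact_seq n \<le> fact_seq (Suc n)"
proof -
  have "\<rho> (Suc n) \<notin> \<rho> ` {..<n}" using inj_rho by (auto dest: injD)
  from fact_seq_le[OF rho_boundary this]
  have "fact_seq n \<le> (\<Sum>j<n. pairing l (\<rho> (Suc n)) (\<rho> j))" .
  also have "\<dots> \<le> fact_seq (Suc n)"
    unfolding tree_factorial_def using pairing_nonneg[OF rho_boundary] by simp
  finally show ?thesis .
qed

text \<open>Only common arcs with head in \<open>D\<close> are counted; the remaining ones
  contribute positive lengths. A finite \<open>D\<close> keeps all energies finite.\<close>

lemma fact_seq_ge:
  assumes D: "finite D" "D \<subseteq> pverts T - {r}"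
  shows "(\<Sum>v\<in>{v \<in> D. v \<in> path_verts (\<rho> n)}. len v * visits n v) \<le> fact_seq n"
proof -
  let ?in = "\<lambda>v j. v \<in> path_verts (\<rho> j)"
  have le: "(\<Sum>v\<in>{v \<in> D. ?in v n}. len v * (if ?in v j then 1 else 0)) \<le> pairing l (\<rho> n) (\<rho> j)"
    if "j < n" for j
  proof -
    let ?E = "{v \<in> D. ?in v n \<and> ?in v j}"
    have arc: "(parent v, v) \<in> path_arcs (\<rho> i) \<longleftrightarrow> ?in v i" if "v \<in> D" for v i
      using head_in_path_verts_iff[OF rho_boundary, of "parent v" v] parent_arc[of v] that D(2) by auto
    have "(\<Sum>v\<in>{v \<in> D. ?in v n}. len v * (if ?in v j then 1 else 0)) = sum len ?E"
    proof -
      have "(\<Sum>v\<in>{v \<in> D. ?in v n}. len v * (if ?in v j then 1 else 0))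
        = (\<Sum>v\<in>{v \<in> D. ?in v n}. if ?in v j then len v else 0)" by (intro sum.cong) auto
      also have "\<dots> = sum len {v \<in> {v \<in> D. ?in v n}. ?in v j}"
        using D(1) by (subst sum.inter_filter) auto
      also have "{v \<in> {v \<in> D. ?in v n}. ?in v j} = ?E" by auto
      finally show ?thesis .
    qed
    also have "\<dots> = sum l ((\<lambda>v. (parent v, v)) ` ?E)"
      by (subst sum.reindex) (auto simp: inj_on_def len_def)
    also have "\<dots> \<le> sum l (path_arcs (\<rho> n) \<inter> path_arcs (\<rho> j))"
    proof (rule sum_mono2)
      show "finite (path_arcs (\<rho> n) \<inter> path_arcs (\<rho> j))"
        by (rule finite_common_arcs[OF rho_boundary rho_boundary rho_distinct[OF that]])
      show "(\<lambda>v. (parent v, v)) ` ?E \<subseteq> path_arcs (\<rho> n) \<inter> path_arcs (\<rho> j)" using arc by blast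
      show "0 \<le> l e" if "e \<in> path_arcs (\<rho> n) \<inter> path_arcs (\<rho> j) - (\<lambda>v. (parent v, v)) ` ?E" for e
        using that path_arcs_subset[OF rho_boundary] length_function
        by (auto simp: length_function_def intro!: less_imp_le)
    qed
    finally show ?thesis by (simp add: pairing_def)
  qed
  have "(\<Sum>v\<in>{v \<in> D. ?in v n}. len v * visits n v)
    = (\<Sum>j<n. \<Sum>v\<in>{v \<in> D. ?in v n}. len v * (if ?in v j then 1 else 0))"
    unfolding visits_eq_sum sum_distrib_left by (rule sum.swap)
  also have "\<dots> \<le> fact_seq n" unfolding tree_factorial_def using le by (intro sum_mono) simp
  finally show ?thesis .
qed

lemma visits_Suc: "visits (Suc n) v = visits n v + (if v \<in> path_verts (\<rho> n) then 1 else 0)"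
proof -
  have "real (visits (Suc n) v) = real (visits n v + (if v \<in> path_verts (\<rho> n) then 1 else 0))"
    by (simp add: visits_eq_sum)
  then show ?thesis by (simp only: of_nat_eq_iff)
qed

text \<open>The left side counts ordered pairs of distinct paths through each arc. A new path
  through \<open>v\<close> adds \<open>2 * visits n v\<close> to the count at \<open>v\<close>, in
  total at most twice the factorial.\<close>

lemma energy_visits_le:
  assumes D: "finite D" "D \<subseteq> pverts T - {r}"
  shows "(\<Sum>v\<in>D. len v * (real (visits n v) * (real (visits n v) - 1))) \<le> 2 * (\<Sum>k<n. fact_seq k)"
proof (induction n)
  case 0
  then show ?case by (simp add: visits_def)
next
  case (Suc n)
  let ?g = "\<lambda>n v. len v * (real (visits n v) * (real (visits n v) - 1))"
  have "(\<Sum>v\<in>D. ?g (Suc n) v)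
    = (\<Sum>v\<in>D. ?g n v + (if v \<in> path_verts (\<rho> n) then 2 * (len v * visits n v) else 0))"
    by (intro sum.cong) (auto simp: visits_Suc algebra_simps)
  also have "\<dots> = (\<Sum>v\<in>D. ?g n v) + (\<Sum>v\<in>{v \<in> D. v \<in> path_verts (\<rho> n)}. 2 * (len v * visits n v))"
    using D(1) by (simp add: sum.distrib sum.inter_filter)
  also have "\<dots> \<le> 2 * (\<Sum>k<n. fact_seq k) + 2 * fact_seq n"
    using Suc fact_seq_ge[OF D, of n] by (simp flip: sum_distrib_left)
  finally show ?case by simp
qed

text \<open>Summation by parts. With \<open>G k\<close> the current into level \<open>k\<close>
  weighted by \<open>1 - pot m\<close>, the energy between two consecutive levels is at most the
  decrease of \<open>G\<close>, and \<open>G\<close> starts at the outflow of the root and stays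
  nonnegative.\<close>

lemma potential_energy_le:
  "(\<Sum>k<K. \<Sum>c\<in>level (Suc k). (pot m c - pot m (parent c)) * flow (pot m) c) \<le> outflow (pot m) r"
proof -
  \<comment> \<open>The current entering \<open>v\<close>; no arc enters the root, so its outflow
    takes that place.\<close>
  define th where "th v = (if v = r then outflow (pot m) v else flow (pot m) v)" for v
  define G where "G k = (\<Sum>v\<in>level k. th v * (1 - pot m v))" for k
  let ?E = "\<lambda>c. (pot m c - pot m (parent c)) * flow (pot m) c"
  have out_le: "outflow (pot m) v \<le> th v" if "v \<in> pverts T" for v
    using outflow_pot_le that by (simp add: th_def)
  have fl: "0 \<le> flow (pot m) c" if "c \<in> children v" for c v
    using flow_nonneg[OF that, of "pot m"] pot_parent_le[OF in_childrenD(2)[OF that] that] by simp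
  have G_Suc: "G (Suc k) + (\<Sum>c\<in>level (Suc k). ?E c) \<le> G k" for k
  proof -
    have "G (Suc k) + (\<Sum>c\<in>level (Suc k). ?E c)
      = (\<Sum>v\<in>level k. \<Sum>c\<in>children v. th c * (1 - pot m c) + ?E c)"
      unfolding G_def sum_level_Suc by (simp add: sum.distrib)
    also have "\<dots> = (\<Sum>v\<in>level k. outflow (pot m) v * (1 - pot m v))"
      unfolding outflow_def sum_distrib_right
      by (intro sum.cong refl) (auto simp: th_def in_childrenD algebra_simps)
    also have "\<dots> \<le> G k"
      unfolding G_def using out_le pot_bounds(2) by (intro sum_mono mult_right_mono) (auto simp: level_def)
    finally show ?thesis .
  qed
  have "(\<Sum>k<K. \<Sum>c\<in>level (Suc k). ?E c) \<le> G 0 - G K"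
  proof (induction K)
    case (Suc K)
    then show ?case using G_Suc[of K] by simp
  qed simp
  moreover have G0: "G 0 = outflow (pot m) r" by (simp add: G_def level_0 th_def)
  moreover have "0 \<le> G K"
  proof (cases K)
    case 0
    have "0 \<le> outflow (pot m) r" unfolding outflow_def by (intro sum_nonneg fl)
    then show ?thesis using G0 0 by simp
  next
    case (Suc k)
    have "0 \<le> th c * (1 - pot m c)" if "c \<in> children v" for c v
      using fl[OF that] in_childrenD(3,4)[OF that] pot_bounds(2) by (simp add: th_def)
    then show ?thesis unfolding G_def Suc sum_level_Suc by (intro sum_nonneg)
  qed
  ultimately show ?thesis by linarith
qed

text \<open>Each path collects the increments of \<open>pot m\<close> down to level
  \<open>K\<close>. Paths that end earlier contribute nonnegative amounts to the right side
  only.\<close>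

lemma visits_flux_le:
  "(\<Sum>v\<in>level K. visits n v * pot m v) \<le> (\<Sum>k<K. \<Sum>c\<in>level (Suc k). visits n c * (pot m c - pot m (parent c)))"
proof (induction K)
  case 0
  then show ?case by (simp add: level_0)
next
  case (Suc K)
  have "(\<Sum>c\<in>level (Suc K). visits n c * pot m c)
    = (\<Sum>v\<in>level K. pot m v * (\<Sum>c\<in>children v. real (visits n c)))
      + (\<Sum>c\<in>level (Suc K). visits n c * (pot m c - pot m (parent c)))"
    unfolding sum_level_Suc sum_distrib_left sum.distrib[symmetric]
    by (intro sum.cong refl) (simp add: in_childrenD algebra_simps)
  also have "(\<Sum>v\<in>level K. pot m v * (\<Sum>c\<in>children v. real (visits n c)))
    \<le> (\<Sum>v\<in>level K. pot m v * visits n v)"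
    using pot_bounds(1) sum_visits_children_real by (intro sum_mono mult_left_mono) (auto simp: level_def)
  finally show ?case using Suc by (simp add: mult.commute)
qed

text \<open>The chosen paths are distinct, and only finitely many boundary paths miss the level, so
  the loss is bounded independently of \<open>n\<close>.\<close>

lemma visits_level_ge:
  "\<exists>L. \<forall>n. real n - L \<le> (\<Sum>v\<in>level k. real (visits n v))"
proof -
  let ?L = "{\<sigma> \<in> boundary T r. path_verts \<sigma> \<inter> level k = {}}"
  have "real n - card ?L \<le> (\<Sum>v\<in>level k. real (visits n v))" for n
  proof -
    let ?bad = "{j \<in> {..<n}. path_verts (\<rho> j) \<inter> level k = {}}"
    have "card ?bad \<le> card ?L"
    proof (rule card_inj_on_le)
      show "inj_on \<rho> ?bad" using inj_rho by (rule inj_on_subset) simp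
    qed (use rho_boundary finite_boundary_shallow in auto)
    then have "real n - card ?L \<le> (\<Sum>j<n. 1 - (if path_verts (\<rho> j) \<inter> level k = {} then 1 else 0))"
      by (simp add: sum_subtractf sum.If_cases Int_def)
    also have "\<dots> \<le> (\<Sum>j<n. \<Sum>v\<in>level k. if v \<in> path_verts (\<rho> j) then 1 else 0)"
    proof (rule sum_mono)
      fix j
      show "1 - (if path_verts (\<rho> j) \<inter> level k = {} then 1 else 0)
        \<le> (\<Sum>v\<in>level k. if v \<in> path_verts (\<rho> j) then 1 else (0::real))"
      proof (cases "path_verts (\<rho> j) \<inter> level k = {}")
        case True
        then show ?thesis by (simp add: sum_nonneg)
      next
        case False
        then obtain v where "v \<in> level k" "v \<in> path_verts (\<rho> j)" by blast
        then show ?thesis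
          using member_le_sum[of v "level k" "\<lambda>v. if v \<in> path_verts (\<rho> j) then 1 else (0::real)"] False
          by simp
      qed
    qed
    also have "\<dots> = (\<Sum>v\<in>level k. real (visits n v))"
      unfolding visits_eq_sum by (rule sum.swap)
    finally show ?thesis .
  qed
  then show ?thesis by blast
qed

text \<open>Cauchy-Schwarz between the flow of the chosen paths and the gradient of
  \<open>pot m\<close>. The constants do not depend on \<open>n\<close>, so both corrections are of
  lower order than \<open>n\<^sup>2\<close>.\<close>

theorem fact_seq_lower:
  "\<exists>L \<Lambda>. \<forall>n. L \<le> real n \<longrightarrow>
    (real n - L)\<^sup>2 \<le> (2 * (\<Sum>k<n. fact_seq k) + real n * \<Lambda>) * outflow (pot m) r"
proof -
  \<comment> \<open>Levels 1 to \<open>Suc m\<close>; on the last of them \<open>pot m\<close>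
    equals 1 by \<open>pot_deep\<close>.\<close>
  define D where "D = (\<Union>k<Suc m. level (Suc k))"
  have sumD: "(\<Sum>k<Suc m. sum f (level (Suc k))) = sum f D" for f :: "'a \<Rightarrow> real"
    unfolding D_def
    by (rule sum.UNION_disjoint[symmetric]) (simp, simp, auto simp: level_def)
  have D: "finite D" by (simp add: D_def)
  have D_sub: "D \<subseteq> pverts T - {r}" by (auto simp: D_def level_def)
  obtain L where L: "\<And>n. real n - L \<le> (\<Sum>v\<in>level (Suc m). real (visits n v))"
    using visits_level_ge by blast
  have "(real n - L)\<^sup>2 \<le> (2 * (\<Sum>k<n. fact_seq k) + n * sum len D) * outflow (pot m) r"
    if n: "L \<le> real n" for n
  proof -
    let ?d = "\<lambda>v. pot m v - pot m (parent v)"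
    have lpos: "0 < len v" if "v \<in> D" for v using that D_sub len_pos by auto
    have "real n - L \<le> (\<Sum>v\<in>level (Suc m). visits n v * pot m v)"
      using L[of n] pot_deep by (simp add: level_def)
    also have "\<dots> \<le> (\<Sum>v\<in>D. visits n v * ?d v)"
      using visits_flux_le[of n m "Suc m"] unfolding sumD .
    finally have 1: "real n - L \<le> (\<Sum>v\<in>D. visits n v * ?d v)" .
    have "(real n - L)\<^sup>2 \<le> (\<Sum>v\<in>D. visits n v * ?d v)\<^sup>2"
      using 1 n by (intro power_mono) auto
    \<comment> \<open>The square roots split each term so that the two factors become the energy of
      the path flow and that of the potential.\<close>
    also have "\<dots> = (\<Sum>v\<in>D. (sqrt (len v) * visits n v) * (?d v / sqrt (len v)))\<^sup>2"
      using lpos by (intro arg_cong[of _ _ "\<lambda>x. x\<^sup>2"] sum.cong) (auto dest: lpos)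
    also have "\<dots> \<le> (\<Sum>v\<in>D. (sqrt (len v) * visits n v)\<^sup>2) * (\<Sum>v\<in>D. (?d v / sqrt (len v))\<^sup>2)"
      by (rule Cauchy_Schwarz_ineq_sum)
    also have "(\<Sum>v\<in>D. (sqrt (len v) * visits n v)\<^sup>2) = (\<Sum>v\<in>D. len v * (real (visits n v))\<^sup>2)"
      using lpos by (intro sum.cong) (auto simp: power_mult_distrib less_imp_le)
    also have "(\<Sum>v\<in>D. (?d v / sqrt (len v))\<^sup>2) = (\<Sum>v\<in>D. ?d v * flow (pot m) v)"
      using lpos by (intro sum.cong) (auto simp: power_divide less_imp_le flow_def power2_eq_square)
    also have "(\<Sum>v\<in>D. len v * (real (visits n v))\<^sup>2) * (\<Sum>v\<in>D. ?d v * flow (pot m) v)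
      \<le> (2 * (\<Sum>k<n. fact_seq k) + n * sum len D) * outflow (pot m) r"
    proof (rule mult_mono)
      \<comment> \<open>The pairs of a path with itself are split off; inside \<open>D\<close> they
        cost at most \<open>n\<close> times the total length.\<close>
      have "(\<Sum>v\<in>D. len v * (real (visits n v))\<^sup>2)
        = (\<Sum>v\<in>D. len v * (real (visits n v) * (real (visits n v) - 1))) + (\<Sum>v\<in>D. len v * visits n v)"
        by (simp add: power2_eq_square algebra_simps flip: sum.distrib)
      also have "(\<Sum>v\<in>D. len v * visits n v) \<le> (\<Sum>v\<in>D. len v * n)"
        using visits_le lpos by (intro sum_mono mult_left_mono) (auto simp: less_imp_le)
      finally show "(\<Sum>v\<in>D. len v * (real (visits n v))\<^sup>2) \<le> 2 * (\<Sum>k<n. fact_seq k) + n * sum len D"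
        using energy_visits_le[OF D D_sub, of n]
          by (simp add: mult.commute flip: sum_distrib_left)
      show "(\<Sum>v\<in>D. ?d v * flow (pot m) v) \<le> outflow (pot m) r"
        using potential_energy_le[of m "Suc m"] unfolding sumD .
      show "0 \<le> 2 * (\<Sum>k<n. fact_seq k) + n * sum len D"
        using lpos fact_seq_nonneg by (intro add_nonneg_nonneg mult_nonneg_nonneg sum_nonneg) (auto simp: less_imp_le)
      have "?d v * flow (pot m) v = (?d v)\<^sup>2 / len v" for v by (simp add: flow_def power2_eq_square)
      then show "0 \<le> (\<Sum>v\<in>D. ?d v * flow (pot m) v)"
        using lpos by (intro sum_nonneg) (simp add: less_imp_le)
    qed
    finally show ?thesis .
  qed
  then show ?thesis by blast
qed

end

section \<open>The limit of the normalised factorials\<close>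

lemma eventually_real_gt: "\<forall>\<^sub>F n in sequentially. x < real n"
  using filterlim_real_sequentially by (simp add: filterlim_at_top_dense)

context factorial_sequence
begin

lemma outflow_pot_nonneg: "0 \<le> outflow (pot m) r"
  using avoid_bounds[OF root_in_verts, of "Suc m"] cond_sum_pos[OF root_in_verts]
  by (simp add: outflow_pot_root del: avoid.simps)

lemma outflow_lpot_nonneg: "0 \<le> outflow lpot r"
  using outflow_pot_nonneg by (intro LIMSEQ_le_const[OF outflow_pot_root_tendsto]) auto

text \<open>The hypothesis says that \<open>a\<close> is below the reciprocal of the strength, in a
  form that admits strength zero. The strict inequality then persists for \<open>pot m\<close> with
  some fixed \<open>m\<close>.\<close>

lemma sum_fact_seq_lower:
  assumes a: "0 \<le> a" "a * outflow lpot r < 1"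
  shows "\<forall>\<^sub>F n in sequentially. a * (real n)\<^sup>2 \<le> 2 * (\<Sum>k<n. fact_seq k)"
proof -
  have "(\<lambda>m. a * outflow (pot m) r) \<longlonglongrightarrow> a * outflow lpot r"
    by (intro tendsto_mult tendsto_const outflow_pot_root_tendsto)
  from order_tendstoD(2)[OF this a(2)] obtain m where m: "a * outflow (pot m) r < 1"
    using eventually_happens[of _ sequentially] by auto
  define s where "s = outflow (pot m) r"
  obtain L \<Lambda> where low: "\<And>n. L \<le> real n \<Longrightarrow>
      (real n - L)\<^sup>2 \<le> (2 * (\<Sum>k<n. fact_seq k) + real n * \<Lambda>) * s"
    using fact_seq_lower[of m] unfolding s_def by blast
  have s: "0 \<le> s" "0 < 1 - a * s" using outflow_pot_nonneg m by (simp_all add: s_def)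
  \<comment> \<open>Beyond this threshold \<open>(1 - a * s) * n\<^sup>2\<close> exceeds the linear
    term left after expanding the square.\<close>
  have "\<forall>\<^sub>F n in sequentially. (2 * L + \<Lambda> * s) / (1 - a * s) < real n \<and> L < real n \<and> 0 < real n"
    by (intro eventually_conj eventually_real_gt)
  then show ?thesis
  proof eventually_elim
    case (elim n)
    let ?Y = "2 * (\<Sum>k<n. fact_seq k)"
    show ?case
    proof (rule ccontr)
      assume "\<not> ?case"
      then have "(?Y + real n * \<Lambda>) * s \<le> (a * (real n)\<^sup>2 + real n * \<Lambda>) * s"
        using s by (intro mult_right_mono) auto
      with low[of n] elim have "(real n - L)\<^sup>2 \<le> (a * (real n)\<^sup>2 + real n * \<Lambda>) * s" by linarith
      then have "real n * (real n * (1 - a * s)) \<le> real n * (2 * L + \<Lambda> * s) - L\<^sup>2"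
        by (simp add: power2_eq_square algebra_simps)
      moreover have "real n * (2 * L + \<Lambda> * s) < real n * (real n * (1 - a * s))"
        using elim s by (intro mult_strict_left_mono) (auto simp: divide_less_eq)
      moreover have "0 \<le> L\<^sup>2" by simp
      ultimately show False by linarith
    qed
  qed
qed

lemma fact_seq_mono: "mono fact_seq"
  using fact_seq_mono_Suc by (simp add: mono_iff_le_Suc)

text \<open>At strength zero every coefficient is admissible in \<open>sum_fact_seq_lower\<close>,
  and by monotonicity the sum is at most \<open>n * fact_seq n\<close>.\<close>

lemma factorial_limit_infinite:
  assumes "outflow lpot r = 0"
  shows "(\<lambda>n. ereal (fact_seq n / real n)) \<longlonglongrightarrow> \<infinity>"
proof -
  have "\<forall>\<^sub>F n in sequentially. x \<le> fact_seq n / real n" for x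
  proof -
    have "\<forall>\<^sub>F n in sequentially. (2 * \<bar>x\<bar>) * (real n)\<^sup>2 \<le> 2 * (\<Sum>k<n. fact_seq k)"
      using assms by (intro sum_fact_seq_lower) auto
    then show ?thesis using eventually_real_gt[of 0]
    proof eventually_elim
      case (elim n)
      have "(\<Sum>k<n. fact_seq k) \<le> (\<Sum>k<n. fact_seq n)"
        using fact_seq_mono by (intro sum_mono) (auto simp: mono_def)
      also have "\<dots> = fact_seq n * real n" by simp
      finally have "(\<bar>x\<bar> * real n) * real n \<le> fact_seq n * real n"
        using elim(1) unfolding power2_eq_square by (simp add: mult.assoc)
      then have "\<bar>x\<bar> * real n \<le> fact_seq n" by (rule mult_right_le_imp_le) (use elim(2) in simp)
      then have "\<bar>x\<bar> \<le> fact_seq n / real n" using elim(2) by (simp add: pos_le_divide_eq)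
      then show ?case by linarith
    qed
  qed
  then have "filterlim (\<lambda>n. fact_seq n / real n) at_top sequentially"
    unfolding filterlim_at_top by blast
  then show ?thesis by (simp add: tendsto_PInfty_eq_at_top)
qed

text \<open>
  Tauberian step: if \<open>fact_seq n \<le> y * n\<close> with \<open>y < H\<close>, monotonicity bounds the terms between
  \<open>(1 - \<delta>) n\<close> and \<open>n\<close>, and \<open>fact_seq k \<le> H * k\<close> the others; with \<open>\<delta> = (H - y) / H\<close> the sum
  is too small for \<open>sum_fact_seq_lower\<close>.
\<close>

lemma factorial_limit_finite:
  assumes s: "0 < outflow lpot r"
  shows "(\<lambda>n. fact_seq n / real n) \<longlonglongrightarrow> 1 / outflow lpot r"
proof (rule order_tendstoI)
  define H where "H = 1 / outflow lpot r"
  have H: "0 < H" using s by (simp add: H_def)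
  have up: "fact_seq n \<le> H * real n" for n using fact_seq_upper[OF s, of n] by (simp add: H_def)
  {
    fix y assume "1 / outflow lpot r < y"
    then have "H < y" by (simp add: H_def)
    show "\<forall>\<^sub>F n in sequentially. fact_seq n / real n < y"
      using eventually_real_gt[of 0]
    proof eventually_elim
      case (elim n)
      have "fact_seq n / real n \<le> H" using up[of n] elim by (simp add: pos_divide_le_eq)
      then show ?case using \<open>H < y\<close> by linarith
    qed
  next
    fix y' assume "y' < 1 / outflow lpot r"
    \<comment> \<open>Nonnegativity of \<open>y\<close> yields
      \<open>(H - y)\<^sup>2 \<le> H * H\<close>, which makes \<open>a\<close> below
      nonnegative.\<close>
    define y where "y = max 0 y'"
    have y: "0 \<le> y" "y < H" "y' \<le> y" using \<open>y' < _\<close> H by (auto simp: y_def H_def)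
    define \<delta> where "\<delta> = (H - y) / H"
    have \<delta>: "0 < \<delta>" "\<delta> \<le> 1" using y H by (auto simp: \<delta>_def)
    \<comment> \<open>The estimate of the sum has leading coefficient
      \<open>H - (H - y)\<^sup>2 / H\<close>; \<open>a\<close> is the midpoint between it and
      \<open>H\<close>.\<close>
    define a where "a = H - (H - y)\<^sup>2 / (2 * H)"
    have "(H - y)\<^sup>2 \<le> H * H" unfolding power2_eq_square using y by (intro mult_mono) auto
    moreover have "0 \<le> H * H" by simp
    ultimately have "(H - y)\<^sup>2 \<le> H * (2 * H)" by linarith
    then have a: "0 \<le> a" "a < H" using y H by (auto simp: a_def pos_divide_le_eq)
    have "a * outflow lpot r < 1" using a(2) s by (simp add: H_def pos_less_divide_eq)
    have id: "H * (1 - \<delta>)\<^sup>2 + 2 * \<delta> * y = H - (H - y)\<^sup>2 / H"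
      using H by (simp add: \<delta>_def power2_eq_square field_simps)
    have "\<forall>\<^sub>F n in sequentially. a * (real n)\<^sup>2 \<le> 2 * (\<Sum>k<n. fact_seq k)"
      by (rule sum_fact_seq_lower) fact+
    \<comment> \<open>This absorbs the term \<open>2 * y * n\<close> that comes from rounding in the
      choice of \<open>k\<close>.\<close>
    moreover have "\<forall>\<^sub>F n in sequentially. 4 * y * H / (H - y)\<^sup>2 < real n"
      by (rule eventually_real_gt)
    ultimately show "\<forall>\<^sub>F n in sequentially. y' < fact_seq n / real n"
      using eventually_real_gt[of 0]
    proof eventually_elim
      case (elim n)
      show ?case
      proof (rule ccontr)
        assume "\<not> ?case"
        then have "fact_seq n \<le> y' * real n" using elim(3) by (simp add: pos_divide_le_eq not_less)
        also have "\<dots> \<le> y * real n" using y(3) by (intro mult_right_mono) auto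
        finally have fy: "fact_seq n \<le> y * real n" .
        define k where "k = nat \<lfloor>(1 - \<delta>) * real n\<rfloor>"
        have "0 \<le> (1 - \<delta>) * real n" using \<delta> by simp
        then have k: "real k \<le> (1 - \<delta>) * real n" "(1 - \<delta>) * real n < real k + 1"
          unfolding k_def by linarith+
        have "(1 - \<delta>) * real n \<le> 1 * real n" using \<delta> by (intro mult_right_mono) auto
        with k(1) have kn: "k \<le> n" by linarith
        have split: "(\<Sum>j<n. fact_seq j) = (\<Sum>j<k. fact_seq j) + (\<Sum>j\<in>{k..<n}. fact_seq j)"
          using kn by (metis atLeast0LessThan le0 sum.atLeastLessThan_concat)
        have "(\<Sum>j\<in>{k..<n}. fact_seq j) \<le> (\<Sum>j\<in>{k..<n}. fact_seq n)"
          using fact_seq_mono by (intro sum_mono) (auto simp: mono_def)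
        also have "\<dots> = (real n - real k) * fact_seq n" using kn by (simp add: of_nat_diff)
        finally have late: "(\<Sum>j\<in>{k..<n}. fact_seq j) \<le> (real n - real k) * fact_seq n" .
        have "2 * (\<Sum>j<k. fact_seq j) \<le> 2 * (\<Sum>j<k. H * real j)"
          by (intro mult_left_mono sum_mono up) simp
        also have "\<dots> = H * (2 * (\<Sum>j<k. real j))" by (simp add: sum_distrib_left algebra_simps)
        also have "2 * (\<Sum>j<k. real j) \<le> (real k)\<^sup>2"
          by (induction k) (auto simp: power2_eq_square algebra_simps)
        finally have early: "2 * (\<Sum>j<k. fact_seq j) \<le> H * (real k)\<^sup>2" using H by simp
        have "2 * (\<Sum>j<n. fact_seq j) \<le> H * (real k)\<^sup>2 + 2 * ((real n - real k) * fact_seq n)"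
          using split early late by linarith
        also have "\<dots> \<le> H * ((1 - \<delta>) * real n)\<^sup>2 + 2 * ((\<delta> * real n + 1) * (y * real n))"
        proof (intro add_mono mult_left_mono power_mono mult_mono fy)
          show "real n - real k \<le> \<delta> * real n + 1" using k(2) by (simp add: algebra_simps)
        qed (use k H kn \<delta> fact_seq_nonneg in auto)
        also have "\<dots> = (H * (1 - \<delta>)\<^sup>2 + 2 * \<delta> * y) * (real n)\<^sup>2 + 2 * y * real n"
          by (simp add: power2_eq_square algebra_simps)
        finally have "a * (real n)\<^sup>2 \<le> (H - (H - y)\<^sup>2 / H) * (real n)\<^sup>2 + 2 * y * real n"
          using elim(1) unfolding id by linarith
        then have "(H - y)\<^sup>2 / (2 * H) * real n * real n \<le> 2 * y * real n"
          by (simp add: a_def power2_eq_square field_simps)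
        then have "(H - y)\<^sup>2 / (2 * H) * real n \<le> 2 * y"
          by (rule mult_right_le_imp_le) (use elim(3) in simp)
        then have "(H - y)\<^sup>2 * real n \<le> 4 * y * H" using H by (simp add: field_simps)
        moreover have "4 * y * H < (H - y)\<^sup>2 * real n"
          using elim(2) y by (simp add: pos_divide_less_eq mult.commute)
        ultimately show False by linarith
      qed
    qed
  }
qed

theorem factorial_limit_eq:
  "factorial_limit l \<rho> = (if outflow lpot r = 0 then \<infinity> else ereal (1 / outflow lpot r))"
proof (cases "outflow lpot r = 0")
  case True
  then show ?thesis unfolding factorial_limit_def using limI[OF factorial_limit_infinite] by simp
next
  case False
  have "(\<lambda>n. ereal (fact_seq n / real n)) \<longlonglongrightarrow> ereal (1 / outflow lpot r)"
    using False factorial_limit_finite outflow_lpot_nonneg by (intro tendsto_ereal) simp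
  from limI[OF this] False show ?thesis unfolding factorial_limit_def by simp
qed

end

section \<open>Transience of the random walk\<close>

locale tree_walk = weighted_tree T r l + prob_space M
  for T :: "'a pair_pre_digraph" and r :: 'a and l :: "'a \<times> 'a \<Rightarrow> real" and M :: "'b measure" +
  fixes X :: "nat \<Rightarrow> 'b \<Rightarrow> 'a"
  assumes walk: "random_walk T r l M X"
begin

lemma X_measurable [measurable]: "X n \<in> measurable M (count_space (pverts T))"
  using walk by (simp add: random_walk_def)

lemma X_0: "AE \<omega> in M. X 0 \<omega> = r"
  using walk by (simp add: random_walk_def)

lemma X_in_verts: "\<omega> \<in> space M \<Longrightarrow> X n \<omega> \<in> pverts T"
  using measurable_space[OF X_measurable] by simp

lemma X_eq_sets [measurable]: "Measurable.pred M (\<lambda>\<omega>. X n \<omega> = v)"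
proof (cases "v \<in> pverts T")
  case True
  then show ?thesis by measurable
next
  case False
  then have "{\<omega> \<in> space M. X n \<omega> = v} = {}" using X_in_verts by auto
  then show ?thesis by (simp add: pred_def)
qed

section \<open>Cylinder events and the Markov property\<close>

definition cyl :: "nat \<Rightarrow> (nat \<Rightarrow> 'a) \<Rightarrow> 'b set" where
  "cyl n x = {\<omega> \<in> space M. \<forall>i\<le>n. X i \<omega> = x i}"

lemma cyl_sets [measurable]: "cyl n x \<in> events"
  unfolding cyl_def by measurable

lemma cyl_Suc: "cyl (Suc n) (x(Suc n := v)) = cyl n x \<inter> {\<omega> \<in> space M. X (Suc n) \<omega> = v}"
  by (auto simp: cyl_def le_Suc_eq)

text \<open>The transition law is given for cylinders of positive probability only; for null
  cylinders both sides vanish.\<close>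

lemma prob_cyl_Suc:
  assumes "v \<in> pverts T"
  shows "prob (cyl (Suc n) (x(Suc n := v))) = prob (cyl n x) * tp (x n) v"
proof (cases "prob (cyl n x) = 0")
  case True
  have "prob (cyl (Suc n) (x(Suc n := v))) \<le> prob (cyl n x)"
    unfolding cyl_Suc by (intro finite_measure_mono) auto
  then show ?thesis using True measure_nonneg[of M "cyl (Suc n) (x(Suc n := v))"] by simp
next
  case False
  then have "\<P>(\<omega> in M. X (Suc n) \<omega> = v \<bar> \<forall>i\<le>n. X i \<omega> = x i) = tp (x n) v"
    using walk assms unfolding random_walk_def cyl_def by blast
  moreover have "{\<omega> \<in> space M. X (Suc n) \<omega> = v \<and> (\<forall>i\<le>n. X i \<omega> = x i)} = cyl (Suc n) (x(Suc n := v))"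
    unfolding cyl_Suc by (auto simp: cyl_def)
  ultimately show ?thesis using False by (simp add: cond_prob_def cyl_def[of n x] field_simps)
qed

text \<open>The transition probabilities to the neighbours sum to 1, so the one-step extensions
  exhaust the cylinder up to a null set.\<close>

lemma prob_cyl_split:
  assumes x: "x n \<in> pverts T" and D: "D \<in> events"
  shows "prob (cyl n x \<inter> D) = (\<Sum>w\<in>neighbours T (x n). prob (cyl (Suc n) (x(Suc n := w)) \<inter> D))"
proof -
  let ?N = "neighbours T (x n)"
  define C where "C w = cyl (Suc n) (x(Suc n := w))" for w
  define U where "U = (\<Union>w\<in>?N. C w)"
  have fin: "finite ?N" by (rule finite_neighbours[OF x])
  have C: "C w \<in> events" "C w \<subseteq> cyl n x" for w by (auto simp: C_def cyl_Suc)
  have disj: "C v \<inter> C w = {}" if "v \<noteq> w" for v w using that by (auto simp: C_def cyl_Suc)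
  have split: "prob (U \<inter> E) = (\<Sum>w\<in>?N. prob (C w \<inter> E))" if "E \<in> events" for E
  proof -
    have "prob (\<Union>w\<in>?N. C w \<inter> E) = (\<Sum>w\<in>?N. prob (C w \<inter> E))"
    proof (rule finite_measure_finite_Union[OF fin])
      show "(\<lambda>w. C w \<inter> E) ` ?N \<subseteq> events" using that C by auto
      show "disjoint_family_on (\<lambda>w. C w \<inter> E) ?N" using disj unfolding disjoint_family_on_def by blast
    qed
    moreover have "U \<inter> E = (\<Union>w\<in>?N. C w \<inter> E)" by (auto simp: U_def)
    ultimately show ?thesis by simp
  qed
  have U: "U \<in> events" "U \<subseteq> cyl n x" using fin C unfolding U_def by blast+
  have "prob (U \<inter> space M) = (\<Sum>w\<in>?N. prob (cyl n x) * tp (x n) w)"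
    unfolding split[OF sets.top]
  proof (rule sum.cong[OF refl])
    fix w assume "w \<in> ?N"
    then have "w \<in> pverts T" using neighbours_in_verts by blast
    moreover have "C w \<inter> space M = C w" using C by (simp add: Int_absorb2 sets.sets_into_space)
    ultimately show "prob (C w \<inter> space M) = prob (cyl n x) * tp (x n) w"
      using prob_cyl_Suc by (simp only: C_def)
  qed
  also have "\<dots> = prob (cyl n x)" using sum_tp[OF x] by (simp flip: sum_distrib_left)
  finally have full: "prob U = prob (cyl n x)" using U by (simp add: Int_absorb2 sets.sets_into_space)
  have "prob (cyl n x - U) = 0" using finite_measure_Diff[OF cyl_sets U] full by simp
  moreover have "prob (cyl n x \<inter> D - U) \<le> prob (cyl n x - U)"
    using U by (intro finite_measure_mono) auto
  ultimately have null: "prob (cyl n x \<inter> D - U) = 0" by (simp add: measure_le_0_iff)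
  have "cyl n x \<inter> D = U \<inter> D \<union> (cyl n x \<inter> D - U)" using U(2) by blast
  then have "prob (cyl n x \<inter> D) = prob (U \<inter> D \<union> (cyl n x \<inter> D - U))" by simp
  also have "\<dots> = prob (U \<inter> D) + prob (cyl n x \<inter> D - U)"
    using U D by (intro finite_measure_Union) auto
  finally show ?thesis using null split[OF D] by (simp add: C_def)
qed

definition no_visit :: "nat \<Rightarrow> nat \<Rightarrow> 'b set" where
  "no_visit n m = {\<omega> \<in> space M. \<forall>k\<in>{n<..n + m}. X k \<omega> \<noteq> r}"

lemma no_visit_sets [measurable]: "no_visit n m \<in> events"
  unfolding no_visit_def by measurable

lemma no_visit_Suc:
  "no_visit n (Suc m) = {\<omega> \<in> space M. X (Suc n) \<omega> \<noteq> r} \<inter> no_visit (Suc n) m"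
proof -
  have "{n<..n + Suc m} = insert (Suc n) {Suc n<..Suc n + m}" by auto
  then show ?thesis by (auto simp: no_visit_def)
qed

text \<open>First-step analysis: splitting the cylinder reproduces the recursion of
  \<open>avoid\<close>.\<close>

lemma prob_cyl_no_visit:
  "x n \<in> pverts T \<Longrightarrow> prob (cyl n x \<inter> no_visit n m) = prob (cyl n x) * avoid m (x n)"
proof (induction m arbitrary: n x)
  case 0
  have "cyl n x \<inter> no_visit n 0 = cyl n x" by (auto simp: no_visit_def cyl_def)
  then show ?case by simp
next
  case (Suc m)
  have "prob (cyl (Suc n) (x(Suc n := w)) \<inter> no_visit n (Suc m))
    = prob (cyl n x) * (tp (x n) w * (if w = r then 0 else avoid m w))" if w: "w \<in> neighbours T (x n)" for w
  proof (cases "w = r")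
    case True
    then have "cyl (Suc n) (x(Suc n := w)) \<inter> no_visit n (Suc m) = {}"
      by (auto simp: cyl_Suc no_visit_Suc)
    then show ?thesis using True by simp
  next
    case False
    then have "cyl (Suc n) (x(Suc n := w)) \<inter> no_visit n (Suc m)
      = cyl (Suc n) (x(Suc n := w)) \<inter> no_visit (Suc n) m"
      by (auto simp: cyl_Suc no_visit_Suc)
    then show ?thesis
      using Suc.IH[of "x(Suc n := w)" "Suc n"] prob_cyl_Suc[of w n x] set_mp[OF neighbours_in_verts w] False
      by (simp only: fun_upd_same if_False mult.assoc)
  qed
  from sum.cong[OF refl this] show ?case
    unfolding prob_cyl_split[where x=x and n=n, OF Suc.prems no_visit_sets]
    by (simp only: sum_distrib_left avoid.simps)
qed

text \<open>Markov property at time \<open>n + k\<close>: the cylinder is extended step by step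
  until it fixes the position at that time.\<close>

lemma prob_cyl_visit_no_visit:
  "x n \<in> pverts T \<Longrightarrow>
    prob (cyl n x \<inter> ({\<omega> \<in> space M. X (n + k) \<omega> = v} \<inter> no_visit (n + k) m))
    = prob (cyl n x \<inter> {\<omega> \<in> space M. X (n + k) \<omega> = v}) * avoid m v"
proof (induction k arbitrary: n x)
  case 0
  have *: "cyl n x \<inter> {\<omega> \<in> space M. X (n + 0) \<omega> = v} = (if x n = v then cyl n x else {})"
    by (auto simp: cyl_def)
  show ?case
    using prob_cyl_no_visit[where x=x and n=n and m=m, OF 0] unfolding Int_assoc[symmetric] * by auto
next
  case (Suc k)
  let ?V = "{\<omega> \<in> space M. X (n + Suc k) \<omega> = v}"
  have "prob (cyl (Suc n) (x(Suc n := w)) \<inter> (?V \<inter> no_visit (n + Suc k) m))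
    = prob (cyl (Suc n) (x(Suc n := w)) \<inter> ?V) * avoid m v" if "w \<in> neighbours T (x n)" for w
    using Suc.IH[of "x(Suc n := w)" "Suc n"] set_mp[OF neighbours_in_verts that]
    by (simp only: fun_upd_same add_Suc add_Suc_right)
  moreover have "?V \<in> events" by measurable
  ultimately show ?case
    using prob_cyl_split[where x=x and n=n, OF Suc.prems, of ?V]
      prob_cyl_split[where x=x and n=n, OF Suc.prems, of "?V \<inter> no_visit (n + Suc k) m"]
    by (simp only: sum_distrib_right sets.Int no_visit_sets cong: sum.cong)
qed

lemma prob_at_root_no_visit:
  "prob ({\<omega> \<in> space M. X k \<omega> = r} \<inter> no_visit k m) = prob {\<omega> \<in> space M. X k \<omega> = r} * avoid m r"
proof -
  \<comment> \<open>The walk starts at the root almost surely, so this cylinder has full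
    probability.\<close>
  have 0: "prob (cyl 0 (\<lambda>_. r) \<inter> D) = prob D" if "D \<in> events" for D
    using that X_0 by (intro finite_measure_eq_AE) (auto simp: cyl_def AE_conj_iff dest: sets.sets_into_space)
  show ?thesis
    using prob_cyl_visit_no_visit[of "\<lambda>_. r" 0 k r m] root_in_verts by (simp add: 0)
qed

section \<open>Last visits to the root\<close>

definition last_visit :: "nat \<Rightarrow> 'b set" where
  "last_visit n = {\<omega> \<in> space M. X n \<omega> = r \<and> (\<forall>k>n. X k \<omega> \<noteq> r)}"

lemma last_visit_sets [measurable]: "last_visit n \<in> events"
  unfolding last_visit_def by measurable

lemma prob_last_visit: "prob (last_visit n) = prob {\<omega> \<in> space M. X n \<omega> = r} * escape r"
proof (rule LIMSEQ_unique)
  let ?A = "\<lambda>m. {\<omega> \<in> space M. X n \<omega> = r} \<inter> no_visit n m"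
  have "(\<Inter>m. ?A m) = last_visit n"
  proof safe
    fix \<omega> assume w: "\<omega> \<in> (\<Inter>m. ?A m)"
    have "X k \<omega> \<noteq> r" if "k > n" for k
    proof -
      have "\<omega> \<in> no_visit n (k - n)" using w by blast
      then show ?thesis using that by (simp add: no_visit_def)
    qed
    then show "\<omega> \<in> last_visit n" using w by (auto simp: last_visit_def)
  qed (auto simp: last_visit_def no_visit_def)
  moreover have "decseq ?A" by (auto simp: decseq_def no_visit_def)
  moreover have "range ?A \<subseteq> events"
  proof (rule image_subsetI)
    show "?A m \<in> events" for m by measurable
  qed
  ultimately show "(\<lambda>m. prob (?A m)) \<longlonglongrightarrow> prob (last_visit n)"
    using finite_Lim_measure_decseq[of ?A] by simp
  show "(\<lambda>m. prob (?A m)) \<longlonglongrightarrow> prob {\<omega> \<in> space M. X n \<omega> = r} * escape r"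
    unfolding prob_at_root_no_visit by (intro tendsto_mult tendsto_const avoid_tendsto root_in_verts)
qed

text \<open>The disjoint events \<open>last_visit n\<close> have summable probabilities. Division by
  \<open>escape r\<close> shows that the probabilities of being at the root are summable, and
  Borel-Cantelli applies.\<close>

lemma transient_if_escape_pos:
  assumes "0 < escape r"
  shows "transient r M X"
proof -
  let ?R = "\<lambda>n. {\<omega> \<in> space M. X n \<omega> = r}"
  have "disjoint_family last_visit"
  proof (unfold disjoint_family_on_def, intro ballI impI)
    fix m n :: nat assume "m \<noteq> n"
    then show "last_visit m \<inter> last_visit n = {}"
      by (cases m n rule: linorder_cases) (auto simp: last_visit_def)
  qed
  moreover have "range last_visit \<subseteq> events" using last_visit_sets by blast
  ultimately have "summable (\<lambda>n. prob (last_visit n))"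
    using finite_measure_UNION[of last_visit] by (simp add: sums_iff)
  then have "summable (\<lambda>n. prob (?R n) * escape r / escape r)"
    unfolding prob_last_visit by (rule summable_divide)
  then have summ: "summable (\<lambda>n. prob (?R n))" using assms by simp
  have "AE \<omega> in M. eventually (\<lambda>n. \<omega> \<in> space M - ?R n) sequentially"
  proof (rule borel_cantelli_AE1)
    show "?R n \<in> events" for n by measurable
    show "emeasure M (?R n) < \<infinity>" for n by (simp add: less_top[symmetric])
    show "summable (\<lambda>n. measure M (?R n))" by (rule summ)
  qed
  then show ?thesis
    unfolding transient_def
  proof eventually_elim
    case (elim \<omega>)
    then obtain N where N: "\<And>n. N \<le> n \<Longrightarrow> X n \<omega> \<noteq> r" unfolding eventually_sequentially by blast
    have "{n. 0 < n \<and> X n \<omega> = r} \<subseteq> {..<N}" using N by (metis (mono_tags, lifting) lessThan_iff mem_Collect_eq not_le subsetI)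
    then show ?case by (rule finite_subset) simp
  qed
qed

text \<open>If \<open>escape r\<close> were 0, almost surely no visit would be the last one; but
  finitely many visits, of which there is one at time 0, have a last one.\<close>

lemma escape_pos_if_transient:
  assumes "transient r M X"
  shows "0 < escape r"
proof (rule ccontr)
  assume "\<not> 0 < escape r"
  moreover have "0 \<le> escape r"
    using avoid_bounds[OF root_in_verts] by (intro LIMSEQ_le_const[OF avoid_tendsto[OF root_in_verts]]) auto
  ultimately have "prob (last_visit n) = 0" for n by (simp add: prob_last_visit)
  then have "AE \<omega> in M. \<omega> \<notin> last_visit n" for n
    by (intro AE_not_in) (auto simp: null_sets_def emeasure_eq_measure)
  then have "AE \<omega> in M. \<forall>n. \<omega> \<notin> last_visit n" by (simp add: AE_all_countable)
  moreover have "AE \<omega> in M. finite {n. 0 < n \<and> X n \<omega> = r}"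
    using assms by (simp add: transient_def)
  ultimately have "AE \<omega> in M. False"
    using X_0 AE_space
  proof eventually_elim
    case (elim \<omega>)
    \<comment> \<open>Transience counts positive times only; time 0 is added as a visit, so the
      maximum exists even without a return.\<close>
    let ?S = "insert 0 {n. 0 < n \<and> X n \<omega> = r}"
    have fin: "finite ?S" using elim by simp
    have "Max ?S \<in> ?S" using fin by (intro Max_in) auto
    then have "X (Max ?S) \<omega> = r" using elim(3) by (elim insertE) simp_all
    moreover have "X k \<omega> \<noteq> r" if "k > Max ?S" for k
    proof
      assume "X k \<omega> = r"
      then have "k \<in> ?S" using that by (cases "k = 0") simp_all
      from Max_ge[OF fin this] that show False by (simp only: not_le)
    qed
    ultimately have "\<omega> \<in> last_visit (Max ?S)" using elim(4)
      unfolding last_visit_def by blast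
    then show ?case using elim(1) by blast
  qed
  then show False by simp
qed

theorem transient_iff_outflow: "transient r M X \<longleftrightarrow> 0 < outflow lpot r"
  using transient_if_escape_pos escape_pos_if_transient cond_sum_pos[OF root_in_verts]
  by (auto simp: outflow_lpot_root zero_less_mult_iff)

end

section \<open>Transience and the factorials\<close>

theorem theorem1p6:
  fixes T :: "'a pair_pre_digraph" and r :: 'a and l :: "'a \<times> 'a \<Rightarrow> real"
    and \<rho> :: "nat \<Rightarrow> 'a root_path" and M :: "'b measure" and X :: "nat \<Rightarrow> 'b \<Rightarrow> 'a"
  assumes "rooted_tree T r"
    and "infinite (pverts T)"
    and "locally_finite T"
    and "infinite {v. branching T v}"
    and "length_function T l"
    and "weakly_complete T l"
    and "minimizing_sequence T r l \<rho>"
    and "random_walk T r l M X"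
  shows "(transient r M X \<longleftrightarrow> factorial_limit l \<rho> < \<infinity>) \<and>
         (recurrent r M X \<longleftrightarrow> factorial_limit l \<rho> = \<infinity>)"
proof -
  have tree: "weighted_tree T r l"
    using assms by (intro weighted_tree.intro weighted_tree_axioms.intro)
  interpret factorial_sequence T r l \<rho>
    using tree assms by (intro factorial_sequence.intro factorial_sequence_axioms.intro)
  have "prob_space M" using assms(8) by (simp add: random_walk_def)
  then interpret tree_walk T r l M X
    using tree assms by (intro tree_walk.intro tree_walk_axioms.intro)
  show ?thesis
    using transient_iff_outflow factorial_limit_eq outflow_lpot_nonneg by (auto simp: recurrent_def)
qed

end
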